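(* Let $0<a<b$ and let $\Pi=\{x+iy: x\in\mathbb{R},\ y>0\}$ be the upper half plane endowed with the Riemannian metric $g=\Psi(y)^2\,(dx^2+dy^2)$, where $\Psi>0$ is defined by $$\Psi(y)^2=\frac{1}{y^2}\Big[\frac{1}{b^2}+\frac{1/a^2-1/b^2}{y+1}\Big],\qquad y>0.$$ The following hold: (i) if $b<2a$, then the operator $\mathcal{M}_\infty$ on $(\Pi,g)$ is unbounded on $L^p(\Pi)$ for all $p$ with $1\le p<b/a$; (ii) if $b>2a$, then the operator $\mathcal{M}_\infty$ on $(\Pi,g)$ is unbounded on $L^p(\Pi)$ for all $p$ with $1\le p<\infty$.
   Context: $\mathcal{M}_\infty f(z)=\sup_{r>1}\frac{1}{\mu(B_r(z))}\int_{B_r(z)}|f|\,d\mu$, where $\mu$ is the Riemannian measure of $g$ and $B_r(z)$ is the open ball with centre $z$ and radius $r$ for the Riemannian distance of $g$. $L^p(\Pi)$ is taken with respect to $\mu$. *)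

theory Defs
  imports "HOL-Analysis.Analysis"
begin

definition upper_half_plane :: "complex set"
  where "upper_half_plane = {z. Im z > 0}"

subsection \<open>Riemannian metrics on a plane domain\<close>

text \<open>A metric \<open>g\<close> assigns to a point \<open>z\<close> a bilinear form \<open>g z\<close> on the tangent space, which is
  identified with \<open>complex\<close>, the coordinate vectors of \<open>x\<close> and \<open>y\<close> being \<open>1\<close> and \<open>\<i>\<close>.\<close>

type_synonym plane_metric = "complex \<Rightarrow> complex \<Rightarrow> complex \<Rightarrow> real"

text \<open>The length is a Lebesgue integral with values in \<open>[0,\<infinity>]\<close>, because \<^const>\<open>valid_path\<close>
  does not bound the derivative near the finitely many exceptional points, so that a valid path may
  have infinite length (for instance \<open>t * sin (1 / t)\<close>). A real-valued integral would then silently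
  take the value \<open>0\<close>.\<close>

definition riem_length :: "plane_metric \<Rightarrow> (real \<Rightarrow> complex) \<Rightarrow> ennreal"
  where "riem_length g \<gamma> =
    (\<integral>\<^sup>+t\<in>{0..1}. ennreal (sqrt (g (\<gamma> t) (vector_derivative \<gamma> (at t)) (vector_derivative \<gamma> (at t))))
      \<partial>lborel)"

definition riem_dist :: "complex set \<Rightarrow> plane_metric \<Rightarrow> complex \<Rightarrow> complex \<Rightarrow> ennreal"
  where "riem_dist S g z w =
    (INF \<gamma> \<in> {\<gamma>. valid_path \<gamma> \<and> path_image \<gamma> \<subseteq> S \<and> pathstart \<gamma> = z \<and> pathfinish \<gamma> = w}.
      riem_length g \<gamma>)"

definition riem_ball :: "complex set \<Rightarrow> plane_metric \<Rightarrow> complex \<Rightarrow> real \<Rightarrow> complex set"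
  where "riem_ball S g z r = {w \<in> S. riem_dist S g z w < ennreal r}"

text \<open>The density is the square root of the determinant of the Gram matrix.\<close>

definition riem_measure :: "complex set \<Rightarrow> plane_metric \<Rightarrow> complex measure"
  where "riem_measure S g =
    density (restrict_space lborel S)
      (\<lambda>z. ennreal (sqrt (g z 1 1 * g z \<i> \<i> - g z 1 \<i> * g z \<i> 1)))"

definition maximal_infty ::
    "complex set \<Rightarrow> plane_metric \<Rightarrow> (complex \<Rightarrow> complex) \<Rightarrow> complex \<Rightarrow> ennreal"
  where "maximal_infty S g f z =
    (SUP r\<in>{1<..}.
      (\<integral>\<^sup>+w\<in>riem_ball S g z r. ennreal (cmod (f w)) \<partial>riem_measure S g) /
      emeasure (riem_measure S g) (riem_ball S g z r))"

subsection \<open>Boundedness on \<open>L\<^sup>p\<close>\<close>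

text \<open>Used for exponents \<open>p > 0\<close> only.\<close>

definition ennreal_powr :: "ennreal \<Rightarrow> real \<Rightarrow> ennreal"
  where "ennreal_powr x p = (if x = \<infinity> then \<infinity> else ennreal (enn2real x powr p))"

definition Lp_norm :: "'a measure \<Rightarrow> real \<Rightarrow> ('a \<Rightarrow> ennreal) \<Rightarrow> ennreal"
  where "Lp_norm M p F = ennreal_powr (\<integral>\<^sup>+x. ennreal_powr (F x) p \<partial>M) (1 / p)"

definition Lp_space :: "'a measure \<Rightarrow> real \<Rightarrow> ('a \<Rightarrow> complex) set"
  where "Lp_space M p =
    {f \<in> borel_measurable M. Lp_norm M p (\<lambda>x. ennreal (cmod (f x))) < \<infinity>}"

text \<open>The operator may take the value \<open>\<infinity>\<close>; the inequality forces \<open>T f\<close> to have finite norm.\<close>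

definition bounded_on_Lp ::
    "'a measure \<Rightarrow> real \<Rightarrow> (('a \<Rightarrow> complex) \<Rightarrow> 'a \<Rightarrow> ennreal) \<Rightarrow> bool"
  where "bounded_on_Lp M p T \<longleftrightarrow>
    (\<exists>C\<ge>0. \<forall>f\<in>Lp_space M p. Lp_norm M p (T f) \<le> ennreal C * Lp_norm M p (\<lambda>x. ennreal (cmod (f x))))"

subsection \<open>The metric \<open>g\<close>\<close>

definition Psi :: "real \<Rightarrow> real \<Rightarrow> real \<Rightarrow> real"
  where "Psi a b y = sqrt (1 / y\<^sup>2 * (1 / b\<^sup>2 + (1 / a\<^sup>2 - 1 / b\<^sup>2) / (y + 1)))"

definition g_metric :: "real \<Rightarrow> real \<Rightarrow> plane_metric"
  where "g_metric a b z u v = (Psi a b (Im z))\<^sup>2 * (Re u * Re v + Im u * Im v)"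

end

theory Submission
  imports Defs "HOL-Real_Asymp.Real_Asymp"
begin

text \<open>Up to bounded errors the distance of two points equals \<open>2 * lam H - lam y - lam y'\<close>, where
  \<open>lam\<close> measures height and \<open>H\<close> is the peak of a geodesic, comparable to the horizontal displacement
  when the latter is large. All volume estimates lose only powers of the radius, which is harmless
  because every condition on the exponents is a strict inequality. Balls are
  tested on the strips with \<open>\<bar>x\<bar> \<le> X\<close> and height comparable to \<open>s\<close>, whose measure is comparable to \<open>X / s\<close>.

  For \<open>b < 2 * a\<close> take the indicator of the strip at height \<open>X\<close>, which has bounded norm. From every
  point of the strip at height \<open>1\<close>, of measure about \<open>X\<close>, it is within distance \<open>ln X / b + O(1)\<close>, and
  the ball of that radius has measure about \<open>X powr (a / b)\<close>. So the maximal function is about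
  \<open>X powr (- a / b)\<close> on a set of measure \<open>X\<close>.

  For \<open>b > 2 * a\<close> take the indicator of the strip at height \<open>1\<close>, of measure about \<open>X\<close>. A ball of radius
  \<open>ln X / a + O(1)\<close> around a point of the strip at height \<open>X powr (2 * a / b - 1)\<close> contains it and still
  has measure about \<open>X\<close>. So the maximal function is about \<open>1\<close> on a set of measure
  \<open>X powr (2 - 2 * a / b)\<close>.\<close>

subsection \<open>Integrals\<close>

text \<open>The fundamental theorem is applied to the gauge integral, since \<open>f'\<close> may
  fail to be Lebesgue integrable near points of \<open>S\<close>. This gives the lower bounds for
  lengths of arbitrary paths.\<close>

lemma FTC_le_nn_integral:
  fixes f f' :: "real \<Rightarrow> real"
  assumes S: "finite S" and uv: "u \<le> v" and cont: "continuous_on {u..v} f"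
    and deriv: "\<And>t. t \<in> {u<..<v} - S \<Longrightarrow> (f has_real_derivative f' t) (at t)"
    and G: "\<And>t. t \<in> {u<..<v} - S \<Longrightarrow> ennreal \<bar>f' t\<bar> \<le> G t"
  shows "ennreal \<bar>f v - f u\<bar> \<le> (\<integral>\<^sup>+t\<in>{u..v}. G t \<partial>lborel)"
proof -
  let ?h = "\<lambda>t. f' t * indicator {u..v} t"
  have hi: "(f' has_integral (f v - f u)) {u..v}"
    using fundamental_theorem_of_calculus_interior_strong[OF S uv _ cont, of f'] deriv
    by (simp add: has_real_derivative_iff_has_vector_derivative)
  then have meas: "?h \<in> borel_measurable lebesgue"
    by (rule has_integral_implies_lebesgue_measurable_real)
  have "ennreal \<bar>f v - f u\<bar> \<le> (\<integral>\<^sup>+t. ennreal \<bar>?h t\<bar> \<partial>lebesgue)"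
  \<comment> \<open>With a finite integral of the absolute value, the gauge integral is a Lebesgue
    integral; with an infinite one the bound is trivial.\<close>
  proof (cases "(\<integral>\<^sup>+t. ennreal \<bar>?h t\<bar> \<partial>lebesgue) < \<infinity>")
    case True
    then have int: "integrable lebesgue ?h"
      using meas by (intro integrableI_bounded) auto
    have "(?h has_integral (f v - f u)) UNIV"
      using hi by (subst (asm) has_integral_restrict_UNIV[symmetric])
        (simp add: indicator_times_eq_if)
    then have "f v - f u = integral\<^sup>L lebesgue ?h"
      using has_integral_integral_lebesgue[OF int] has_integral_unique by blast
    then show ?thesis
      using integral_norm_bound_ennreal[OF int] by simp
  next
    case False
    then show ?thesis by (simp add: top.not_eq_extremum[symmetric])
  qed
  also have "\<dots> = (\<integral>\<^sup>+t. ennreal \<bar>?h t\<bar> \<partial>lborel)"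
    by (rule nn_integral_completion)
  also have "\<dots> \<le> (\<integral>\<^sup>+t\<in>{u..v}. G t \<partial>lborel)"
  proof (rule nn_integral_mono_AE)
    have "finite (S \<union> {u, v})" using S by simp
    then have "AE t in lborel. t \<notin> S \<union> {u, v}"
      by (intro AE_not_in finite_imp_null_set_lborel)
    then show "AE t in lborel. ennreal \<bar>?h t\<bar> \<le> G t * indicator {u..v} t"
      by eventually_elim (use G in \<open>auto simp: indicator_def\<close>)
  qed
  finally show ?thesis .
qed

lemma nn_integral_split_Icc:
  fixes G :: "real \<Rightarrow> ennreal"
  assumes "u \<le> c" "c \<le> v"
  assumes [measurable]: "G \<in> borel_measurable borel"
  shows "(\<integral>\<^sup>+t\<in>{u..c}. G t \<partial>lborel) + (\<integral>\<^sup>+t\<in>{c..v}. G t \<partial>lborel) = (\<integral>\<^sup>+t\<in>{u..v}. G t \<partial>lborel)"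
proof -
  have "(\<integral>\<^sup>+t\<in>{u..v}. G t \<partial>lborel) = (\<integral>\<^sup>+t. G t * indicator {u..c} t + G t * indicator {c..v} t \<partial>lborel)"
  proof (rule nn_integral_cong_AE)
    show "AE t in lborel. G t * indicator {u..v} t = G t * indicator {u..c} t + G t * indicator {c..v} t"
      using AE_lborel_singleton[of c] by eventually_elim (use assms in \<open>auto simp: indicator_def\<close>)
  qed
  then show ?thesis by (simp add: nn_integral_add)
qed

text \<open>For upper bounds: the speed of an explicit path is dominated by the derivative of a
  known \<open>F\<close>.\<close>

lemma nn_integral_le_FTC:
  fixes F G h :: "real \<Rightarrow> real"
  assumes "u \<le> v" and [measurable]: "h \<in> borel_measurable borel"
    and F: "\<And>t. t \<in> {u..v} \<Longrightarrow> (F has_real_derivative h t) (at t)"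
    and G: "\<And>t. t \<in> {u..v} \<Longrightarrow> 0 \<le> G t" "\<And>t. t \<in> {u..v} \<Longrightarrow> G t \<le> h t"
  shows "(\<integral>\<^sup>+t\<in>{u..v}. ennreal (G t) \<partial>lborel) \<le> ennreal (F v - F u)"
proof -
  have "(\<integral>\<^sup>+t\<in>{u..v}. ennreal (G t) \<partial>lborel) \<le> (\<integral>\<^sup>+t\<in>{u..v}. ennreal (h t) \<partial>lborel)"
    using G(2) by (intro nn_integral_mono) (auto simp: indicator_def ennreal_leI)
  also have "\<dots> = ennreal (F v - F u)"
    using assms order_trans[OF G] by (intro nn_integral_FTC_Icc) (auto intro: has_field_derivative_at_within)
  finally show ?thesis .
qed

subsection \<open>Strips and maximal functions\<close>

text \<open>The height ratio \<open>exp 1\<close> lets \<open>ln (Im z)\<close> range over an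
  interval of length one, so strips whose bottoms grow by factors \<open>exp 1\<close> leave no
  gap.\<close>

definition strip :: "real \<Rightarrow> real \<Rightarrow> real \<Rightarrow> complex set"
  where "strip x X s = cbox (Complex (x - X) s) (Complex (x + X) (exp 1 * s))"

lemma in_strip_iff: "z \<in> strip x X s \<longleftrightarrow> \<bar>Re z - x\<bar> \<le> X \<and> s \<le> Im z \<and> Im z \<le> exp 1 * s"
  by (auto simp: strip_def in_cbox_complex_iff)

lemma strip_subset_upper_half_plane: "0 < s \<Longrightarrow> strip x X s \<subseteq> upper_half_plane"
  by (auto simp: in_strip_iff upper_half_plane_def)

lemma emeasure_lborel_strip:
  assumes "0 \<le> X" "0 \<le> s"
  shows "emeasure lborel (strip x X s) = ennreal (2 * X * ((exp 1 - 1) * s))"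
proof -
  have "s \<le> exp 1 * s" using mult_right_mono[of 1 "exp 1" s] assms by simp
  then show ?thesis
    using assms unfolding strip_def
    by (subst emeasure_lborel_cbox) (auto simp: Basis_complex_def algebra_simps)
qed

lemma upper_half_plane_borel [measurable]: "upper_half_plane \<in> sets borel"
proof -
  have "upper_half_plane = Im -` {0<..} \<inter> space borel"
    by (auto simp: upper_half_plane_def)
  also have "\<dots> \<in> sets borel" by measurable
  finally show ?thesis .
qed

lemma set_nn_integral_mono:
  fixes f g :: "'a \<Rightarrow> ennreal"
  assumes "\<And>x. x \<in> A \<Longrightarrow> f x \<le> g x"
  shows "(\<integral>\<^sup>+x\<in>A. f x \<partial>M) \<le> (\<integral>\<^sup>+x\<in>A. g x \<partial>M)"
  using assms by (intro nn_integral_mono) (auto simp: indicator_def)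

section \<open>Testing boundedness on indicator functions\<close>

lemma ennreal_powr_mono: "x \<le> y \<Longrightarrow> 0 \<le> q \<Longrightarrow> ennreal_powr x q \<le> ennreal_powr y q"
  by (auto simp: ennreal_powr_def top_unique powr_mono2 enn2real_mono less_top intro!: ennreal_leI)

lemma ennreal_powr_ennreal [simp]: "0 \<le> x \<Longrightarrow> ennreal_powr (ennreal x) q = ennreal (x powr q)"
  by (simp add: ennreal_powr_def)

text \<open>Chebyshev's inequality for the test function \<open>indicator E\<close>. The function
  \<open>m powr p * indicator Z\<close> lies below the \<open>p\<close>-th power of the image, and
  monotonicity of the integral does not ask for that image to be measurable.\<close>

lemma bounded_on_Lp_weak_type:
  assumes bd: "bounded_on_Lp M p T" and p: "0 < p"
  obtains C where "0 \<le> C"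
    "\<And>E Z m. E \<in> fmeasurable M \<Longrightarrow> Z \<in> fmeasurable M \<Longrightarrow> 0 \<le> m \<Longrightarrow>
      (\<And>z. z \<in> Z \<Longrightarrow> ennreal m \<le> T (indicator E) z) \<Longrightarrow>
      m powr p * measure M Z \<le> C * measure M E"
proof -
  obtain C where C: "0 \<le> C" "\<And>f. f \<in> Lp_space M p \<Longrightarrow>
      Lp_norm M p (T f) \<le> ennreal C * Lp_norm M p (\<lambda>x. ennreal (cmod (f x)))"
    using bd unfolding bounded_on_Lp_def by auto
  have "m powr p * measure M Z \<le> C powr p * measure M E"
    if E: "E \<in> fmeasurable M" and Z: "Z \<in> fmeasurable M" and m: "0 \<le> m"
      and ge: "\<And>z. z \<in> Z \<Longrightarrow> ennreal m \<le> T (indicator E) z" for E Z m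
  proof -
    have em: "emeasure M E = ennreal (measure M E)" "emeasure M Z = ennreal (measure M Z)"
      using E Z by (auto simp: emeasure_eq_measure2)
    have [measurable]: "E \<in> sets M" "Z \<in> sets M" using E Z by auto
    have "ennreal_powr (ennreal (cmod (indicator E x))) p = indicator E x" for x
      using p by (auto simp: indicator_def ennreal_powr_def)
    then have norm_E: "Lp_norm M p (\<lambda>x. ennreal (cmod (indicator E x))) = ennreal (measure M E powr (1 / p))"
      by (simp add: Lp_norm_def em)
    then have "(indicator E :: _ \<Rightarrow> complex) \<in> Lp_space M p"
      by (simp add: Lp_space_def)
    from C(2)[OF this] have "Lp_norm M p (T (indicator E)) \<le> ennreal (C * measure M E powr (1 / p))"
      using C(1) by (simp add: norm_E ennreal_mult)
    moreover have "ennreal ((m powr p * measure M Z) powr (1 / p)) \<le> Lp_norm M p (T (indicator E))"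
    proof -
      have "ennreal (m powr p * measure M Z) = (\<integral>\<^sup>+x. ennreal (m powr p) * indicator Z x \<partial>M)"
        by (simp add: nn_integral_cmult_indicator em ennreal_mult)
      also have "\<dots> \<le> (\<integral>\<^sup>+x. ennreal_powr (T (indicator E) x) p \<partial>M)"
        using ennreal_powr_mono[OF ge, of _ p] p m
        by (intro nn_integral_mono) (auto simp: indicator_def)
      finally show ?thesis
        using ennreal_powr_mono[of "ennreal (m powr p * measure M Z)" _ "1 / p"] p
        by (simp add: Lp_norm_def)
    qed
    ultimately have "(m powr p * measure M Z) powr (1 / p) \<le> C * measure M E powr (1 / p)"
      using C(1) by (metis ennreal_le_iff mult_nonneg_nonneg order_trans powr_ge_zero)
    then have "((m powr p * measure M Z) powr (1 / p)) powr p \<le> (C * measure M E powr (1 / p)) powr p"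
      using p by (intro powr_mono2) auto
    then show ?thesis
      using p m C(1) by (simp add: powr_powr powr_mult)
  qed
  then show thesis by (intro that[of "C powr p"]) auto
qed

lemma ennreal_inverse_antimono: "inverse y \<le> inverse x" if "x \<le> y" for x y :: ennreal
  using that by (simp add: less_eq_ennreal.rep_eq inverse_ennreal.rep_eq ereal_inverse_antimono)

text \<open>One radius already bounds the supremum from below, and as the ball contains
  \<open>E\<close>, the numerator is the full measure of \<open>E\<close>.\<close>

lemma maximal_infty_indicator_ge:
  assumes r: "1 < r" and E: "E \<in> sets (riem_measure S g)" "E \<subseteq> riem_ball S g z r"
    and V: "emeasure (riem_measure S g) (riem_ball S g z r) \<le> V"
  shows "emeasure (riem_measure S g) E / V \<le> maximal_infty S g (indicator E) z"
proof -
  let ?B = "riem_ball S g z r"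
  have "ennreal (cmod (indicator E w)) * indicator ?B w = indicator E w" for w
    using E(2) by (auto simp: indicator_def)
  then have "(\<integral>\<^sup>+w\<in>?B. ennreal (cmod (indicator E w)) \<partial>riem_measure S g) = emeasure (riem_measure S g) E"
    using E(1) by simp
  moreover have "emeasure (riem_measure S g) E / V
      \<le> emeasure (riem_measure S g) E / emeasure (riem_measure S g) ?B"
    unfolding divide_ennreal_def using V by (intro mult_left_mono ennreal_inverse_antimono) auto
  ultimately show ?thesis
    unfolding maximal_infty_def using r by (intro SUP_upper2[of r]) auto
qed

text \<open>In the application \<open>\<alpha>\<close>, \<open>\<zeta>\<close> and
  \<open>\<kappa>\<close> are the growth rates of the measures of the test set, of the set where the
  maximal function is large, and of the balls. A positive net rate lets the left side outgrow the
  right despite the polynomial loss.\<close>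

lemma exp_growth_contradiction:
  fixes p c c' K C \<alpha> \<kappa> \<zeta> \<delta> :: real
  assumes p: "0 < p" and c: "0 < c" "0 < c'" and K: "0 < K" and \<delta>: "0 < p * (\<alpha> - \<kappa>) + \<zeta> - \<alpha>"
    and le: "\<And>L. 1 \<le> L \<Longrightarrow> (c * exp (\<alpha> * L) / (K * (L + 1)\<^sup>2 * exp (\<kappa> * L))) powr p * (c' * exp (\<zeta> * L))
      \<le> C * exp (\<alpha> * L)"
  shows False
proof -
  \<comment> \<open>\<open>d\<close> is the rate left after division by
    \<open>exp (\<alpha> * L)\<close>; \<open>k\<close> collects the constants.\<close>
  define d where "d = p * (\<alpha> - \<kappa>) + \<zeta> - \<alpha>"
  define k where "k = (c / K) powr p * c'"
  have k: "0 < k" using c K by (simp add: k_def)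
  have "k * (exp (d * L) / (L + 1) powr (2 * p)) \<le> C" if L: "1 \<le> L" for L
  proof -
    have "(L + 1)\<^sup>2 = (L + 1) powr 2" using L by simp
    then have sq: "(L + 1)\<^sup>2 powr p = (L + 1) powr (p * 2)" by (simp only: powr_powr mult.commute)
    have "c * exp (\<alpha> * L) / (K * (L + 1)\<^sup>2 * exp (\<kappa> * L))
        = (c / K) * exp ((\<alpha> - \<kappa>) * L) / (L + 1)\<^sup>2"
      using L by (simp add: exp_diff left_diff_distrib)
    also have "\<dots> powr p = (c / K) powr p * exp (p * (\<alpha> - \<kappa>) * L) / (L + 1) powr (2 * p)"
      using c K L sq by (simp add: powr_divide powr_mult powr_powr exp_powr_real mult_ac)
    finally have eq: "(c * exp (\<alpha> * L) / (K * (L + 1)\<^sup>2 * exp (\<kappa> * L))) powr p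
        = (c / K) powr p * exp (p * (\<alpha> - \<kappa>) * L) / (L + 1) powr (2 * p)" .
    have "(c / K) powr p * exp (p * (\<alpha> - \<kappa>) * L) / (L + 1) powr (2 * p) * (c' * exp (\<zeta> * L))
        / exp (\<alpha> * L) \<le> C"
      using le[OF L] unfolding eq pos_divide_le_eq[OF exp_gt_zero] .
    also have "(c / K) powr p * exp (p * (\<alpha> - \<kappa>) * L) / (L + 1) powr (2 * p) * (c' * exp (\<zeta> * L)) / exp (\<alpha> * L)
        = k * (exp (p * (\<alpha> - \<kappa>) * L + \<zeta> * L - \<alpha> * L) / (L + 1) powr (2 * p))"
      by (simp add: k_def exp_add exp_diff mult_ac)
    also have "p * (\<alpha> - \<kappa>) * L + \<zeta> * L - \<alpha> * L = d * L" by (simp add: d_def algebra_simps)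
    finally show ?thesis .
  qed
  moreover have "filterlim (\<lambda>L. k * (exp (d * L) / (L + 1) powr (2 * p))) at_top at_top"
    using k p \<delta> unfolding d_def[symmetric] by real_asymp
  then have "eventually (\<lambda>L. k * (exp (d * L) / (L + 1) powr (2 * p)) > C) at_top"
    by (simp add: filterlim_at_top_dense)
  then have "eventually (\<lambda>L. k * (exp (d * L) / (L + 1) powr (2 * p)) > C \<and> 1 \<le> L) at_top"
    using eventually_ge_at_top by (rule eventually_conj)
  then obtain L where "k * (exp (d * L) / (L + 1) powr (2 * p)) > C" "1 \<le> L"
    using eventually_happens by fastforce
  ultimately show False by force
qed

subsection \<open>The height function\<close>

text \<open>\<open>lam\<close> replaces the height function with derivative \<open>Psi a b\<close>, from which it differs by a bounded
  amount: \<open>y * lam' a b y\<close> is the chord of the concave function \<open>t \<mapsto> sqrt (1 / b\<^sup>2 + (1 / a\<^sup>2 - 1 / b\<^sup>2) * t)\<close>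
  over \<open>{0..1}\<close>, evaluated at \<open>t = 1 / (1 + y)\<close>, whereas \<open>y * Psi a b y\<close> is the function itself.\<close>

definition lam :: "real \<Rightarrow> real \<Rightarrow> real \<Rightarrow> real"
  where "lam a b y = ln y / a - (1 / a - 1 / b) * ln (1 + y)"

definition lam' :: "real \<Rightarrow> real \<Rightarrow> real \<Rightarrow> real"
  where "lam' a b y = 1 / (b * y) + (1 / a - 1 / b) / (y * (1 + y))"

lemma has_real_derivative_lam:
  assumes "0 < y"
  shows "(lam a b has_real_derivative lam' a b y) (at y within S)"
  unfolding lam_def[abs_def] lam'_def
  using assms by (auto intro!: derivative_eq_intros simp: divide_simps) (simp add: algebra_simps)

context
  fixes a b :: real
  assumes a: "0 < a" and ab: "a < b"
begin

lemma lam'_ge: "0 < y \<Longrightarrow> 1 / (b * y) \<le> lam' a b y"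
  using a ab by (simp add: lam'_def frac_le)

lemma lam'_pos: "0 < y \<Longrightarrow> 0 < lam' a b y"
  by (rule less_le_trans[OF _ lam'_ge]) (use a ab in auto)

lemma lam_mono:
  assumes "0 < x" "x \<le> y" shows "lam a b x \<le> lam a b y"
  using assms(2)
proof (rule DERIV_nonneg_imp_nondecreasing)
  fix t assume "x \<le> t" "t \<le> y"
  then have "0 < t" using assms by auto
  then show "\<exists>d. (lam a b has_real_derivative d) (at t) \<and> 0 \<le> d"
    using has_real_derivative_lam lam'_pos less_imp_le by blast
qed

text \<open>By \<open>lam'_ge\<close>, \<open>b * lam a b t - ln t\<close> has nonnegative
  derivative. Hence a bound \<open>r\<close> on the change of \<open>lam\<close> confines the height
  to a factor \<open>exp (b * r)\<close>.\<close>

lemma ln_diff_le_lam: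
  assumes "0 < x" "x \<le> y" shows "ln y - ln x \<le> b * (lam a b y - lam a b x)"
proof -
  have "b * lam a b x - ln x \<le> b * lam a b y - ln y"
  proof (rule DERIV_nonneg_imp_nondecreasing[OF assms(2)])
    fix t assume "x \<le> t" "t \<le> y"
    then have t: "0 < t" using assms by auto
    have "((\<lambda>t. b * lam a b t - ln t) has_real_derivative (b * lam' a b t - 1 / t)) (at t)"
      using DERIV_diff[OF DERIV_cmult[OF has_real_derivative_lam[OF t, of a b UNIV], of b] DERIV_ln[OF t]]
      by (simp add: inverse_eq_divide)
    moreover have "0 \<le> b * lam' a b t - 1 / t"
      using mult_left_mono[OF lam'_ge[OF t], of b] a ab t by simp
    ultimately show "\<exists>d. ((\<lambda>t. b * lam a b t - ln t) has_real_derivative d) (at t) \<and> 0 \<le> d"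
      by blast
  qed
  then show ?thesis by (simp add: algebra_simps)
qed

lemma inverse_diff_pos: "0 < 1 / a - 1 / b"
  using a ab by (simp add: field_simps)

text \<open>This and the next three lemmas describe the two regimes: \<open>ln (1 + y)\<close> is
  bounded for \<open>y \<le> 1\<close> and close to \<open>ln y\<close> for
  \<open>y \<ge> 1\<close>, so up to a constant \<open>lam\<close> is \<open>ln y / a\<close> low
  down and \<open>ln y / b\<close> high up.\<close>

lemma lam_le_a: "0 < y \<Longrightarrow> lam a b y \<le> ln y / a"
  using inverse_diff_pos by (simp add: lam_def)

lemma lam_le_b: 
  assumes "0 < y" shows "lam a b y \<le> ln y / b"
proof -
  have "lam a b y = ln y / b - (1 / a - 1 / b) * (ln (1 + y) - ln y)"
    by (simp add: lam_def algebra_simps)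
  moreover have "0 \<le> (1 / a - 1 / b) * (ln (1 + y) - ln y)"
    using inverse_diff_pos assms by (intro mult_nonneg_nonneg) auto
  ultimately show ?thesis by linarith
qed

lemma lam_ge_a: 
  assumes "0 < y" "y \<le> 1" shows "ln y / a - (1 / a - 1 / b) * ln 2 \<le> lam a b y"
proof -
  have "(1 / a - 1 / b) * ln (1 + y) \<le> (1 / a - 1 / b) * ln 2"
    using inverse_diff_pos assms by (intro mult_left_mono) auto
  then show ?thesis by (simp add: lam_def)
qed

lemma lam_ge_b: 
  assumes "1 \<le> y" shows "ln y / b - (1 / a - 1 / b) * ln 2 \<le> lam a b y"
proof -
  have "ln (1 + y) \<le> ln (2 * y)" using assms by simp
  then have "ln (1 + y) - ln y \<le> ln 2" using assms by (simp add: ln_mult)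
  then have "(1 / a - 1 / b) * (ln (1 + y) - ln y) \<le> (1 / a - 1 / b) * ln 2"
    using inverse_diff_pos by (intro mult_left_mono) auto
  then show ?thesis by (simp add: lam_def algebra_simps)
qed

section \<open>The conformal factor compared with the derivative of \<open>lam\<close>\<close>

lemma Psi_eq:
  assumes "0 < y"
  shows "Psi a b y = sqrt (1 / b\<^sup>2 + (1 / a\<^sup>2 - 1 / b\<^sup>2) / (y + 1)) / y"
  using assms by (simp add: Psi_def real_sqrt_mult real_sqrt_divide)

lemma Psi_nonneg: "0 < y \<Longrightarrow> 0 \<le> Psi a b y"
proof -
  assume y: "0 < y"
  have "1 / b\<^sup>2 \<le> 1 / a\<^sup>2" using a ab by (intro divide_left_mono power_mono) auto
  then show ?thesis using y by (simp add: Psi_eq)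
qed

text \<open>The radicand is exactly the square of the chord plus
  \<open>c\<^sup>2 * (t * (1 - t))\<close>, which vanishes at both ends of the unit
  interval.\<close>

lemma sqrt_chord:
  fixes t :: real
  defines "c \<equiv> 1 / a - 1 / b"
  assumes t: "0 < t" "t < 1"
  shows "1 / b + c * t \<le> sqrt (1 / b\<^sup>2 + (1 / a\<^sup>2 - 1 / b\<^sup>2) * t)" (is "?l \<le> sqrt ?s")
    and "sqrt (1 / b\<^sup>2 + (1 / a\<^sup>2 - 1 / b\<^sup>2) * t) \<le> 1 / b + c * t + b * (c\<^sup>2 * (t * (1 - t)))"
proof -
  have b: "b > 0" using a ab by auto
  have c: "c \<ge> 0" using inverse_diff_pos by (simp add: c_def)
  have D: "1 / a\<^sup>2 - 1 / b\<^sup>2 = c * (c + 2 / b)"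
    by (simp add: c_def power2_eq_square algebra_simps)
  define e where "e = c\<^sup>2 * (t * (1 - t))"
  have e: "e \<ge> 0" using t by (simp add: e_def)
  have s: "?s = ?l\<^sup>2 + e"
    unfolding D e_def by (simp add: power2_eq_square algebra_simps)
  show "?l \<le> sqrt ?s" using e by (intro real_le_rsqrt) (simp only: s)
  \<comment> \<open>The chord is at least \<open>1 / b\<close>, so adding \<open>b * e\<close> to it
    raises its square by at least \<open>2 * e\<close>.\<close>
  have "e \<le> 2 * ?l * (b * e)"
  proof -
    have "2 * ?l * (b * e) = 2 * e + 2 * c * t * b * e"
      using b by (simp add: field_simps)
    then show ?thesis using b c t e by simp
  qed
  then have "?s \<le> ?l\<^sup>2 + 2 * ?l * (b * e) + (b * e)\<^sup>2"
    unfolding s using zero_le_power2[of "b * e"] by linarith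
  also have "\<dots> = (?l + b * e)\<^sup>2"
    by (simp add: power2_sum)
  finally show "sqrt ?s \<le> ?l + b * e"
    using b c t e by (intro real_le_lsqrt) simp_all
qed

lemma lam'_eq:
  assumes "0 < y"
  shows "lam' a b y = (1 / b + (1 / a - 1 / b) * (1 / (1 + y))) / y"
  by (simp add: lam'_def add_divide_distrib mult.commute)

lemma lam'_le_Psi:
  assumes y: "0 < y" shows "lam' a b y \<le> Psi a b y"
  unfolding lam'_eq[OF y] Psi_eq[OF y]
  using sqrt_chord(1)[of "1 / (1 + y)"] y by (intro divide_right_mono) (simp_all add: add.commute)

text \<open>The error is integrable over all heights, with total
  \<open>b * (1 / a - 1 / b)\<^sup>2\<close>; this is why replacing \<open>Psi\<close> by
  \<open>lam'\<close> costs only a bounded amount of length.\<close>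

lemma Psi_le_lam':
  assumes y: "0 < y"
  shows "Psi a b y \<le> lam' a b y + b * (1 / a - 1 / b)\<^sup>2 / (1 + y)\<^sup>2"
proof -
  define c where "c = 1 / a - 1 / b"
  define t where "t = 1 / (1 + y)"
  have "Psi a b y \<le> (1 / b + c * t + b * (c\<^sup>2 * (t * (1 - t)))) / y"
    unfolding Psi_eq[OF y] using sqrt_chord(2)[of t] y
    by (intro divide_right_mono) (simp_all add: t_def c_def add.commute)
  also have "\<dots> = lam' a b y + b * c\<^sup>2 * (t * (1 - t) / y)"
    unfolding lam'_eq[OF y] c_def t_def by (simp add: add_divide_distrib)
  also have "t * (1 - t) / y = 1 / (1 + y)\<^sup>2"
    using y by (simp add: t_def power2_eq_square divide_simps)
  finally show ?thesis by (simp add: c_def)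
qed

text \<open>Together with \<open>Psi_le\<close> this pinches the metric between two constant
  multiples of the hyperbolic metric.\<close>

lemma Psi_ge: "0 < y \<Longrightarrow> 1 / (b * y) \<le> Psi a b y"
  using lam'_ge lam'_le_Psi by fastforce

lemma Psi_le:
  assumes y: "0 < y" shows "Psi a b y \<le> 1 / (a * y)"
proof -
  have "1 / b\<^sup>2 \<le> 1 / a\<^sup>2" using a ab by (intro divide_left_mono power_mono) auto
  then have "(1 / a\<^sup>2 - 1 / b\<^sup>2) / (y + 1) \<le> (1 / a\<^sup>2 - 1 / b\<^sup>2) / 1"
    using y by (intro divide_left_mono) auto
  then have "sqrt (1 / b\<^sup>2 + (1 / a\<^sup>2 - 1 / b\<^sup>2) / (y + 1)) \<le> sqrt (1 / a\<^sup>2)"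
    by (intro real_sqrt_le_mono) simp
  also have "\<dots> = 1 / a" using a by (simp add: real_sqrt_divide)
  finally show ?thesis using y by (simp add: Psi_eq divide_right_mono divide_divide_eq_left flip: divide_divide_eq_left)
qed

subsection \<open>Distances\<close>

lemma sqrt_g_metric:
  assumes "0 < Im z"
  shows "sqrt (g_metric a b z v v) = Psi a b (Im z) * cmod v"
  using Psi_nonneg[OF assms]
  by (simp add: g_metric_def real_sqrt_mult cmod_def power2_eq_square)

lemma continuous_on_Psi: "continuous_on {0<..} (Psi a b)"
  unfolding Psi_def by (intro continuous_intros) (auto simp: add_pos_pos less_imp_neq[symmetric])

text \<open>The path is cut at its highest point \<open>\<gamma> t\<close>. As
  \<open>lam' \<le> Psi\<close>, the length of each piece is at least the change of
  \<open>lam\<close> along it. For the second bound, \<open>Psi\<close> is at least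
  \<open>1 / (b * Im (\<gamma> t))\<close> along the whole path, which controls horizontal
  motion.\<close>

lemma riem_length_bounds:
  assumes \<gamma>: "valid_path \<gamma>" and im: "path_image \<gamma> \<subseteq> upper_half_plane"
    and t: "t \<in> {0..1}" and max: "\<And>s. s \<in> {0..1} \<Longrightarrow> Im (\<gamma> s) \<le> Im (\<gamma> t)"
  defines "h \<equiv> lam a b (Im (\<gamma> t))"
  shows "ennreal (2 * h - lam a b (Im (pathstart \<gamma>)) - lam a b (Im (pathfinish \<gamma>)))
      \<le> riem_length (g_metric a b) \<gamma>" (is ?A)
    and "ennreal (\<bar>Re (pathfinish \<gamma>) - Re (pathstart \<gamma>)\<bar> / (b * Im (\<gamma> t)))
      \<le> riem_length (g_metric a b) \<gamma>" (is ?B)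
proof -
  obtain S where S: "finite S" and cont: "continuous_on {0..1} \<gamma>"
    and diff: "\<And>s. s \<in> {0..1} - S \<Longrightarrow> \<gamma> differentiable at s"
    and cont': "continuous_on ({0..1} - S) (\<lambda>s. vector_derivative \<gamma> (at s))"
    using \<gamma> unfolding valid_path_def piecewise_C1_differentiable_on_def C1_differentiable_on_eq
    by blast
  define d where "d s = vector_derivative \<gamma> (at s)" for s
  have der: "(\<gamma> has_vector_derivative d s) (at s)" if "s \<in> {0..1} - S" for s
    using diff[OF that] by (simp add: d_def vector_derivative_works)
  have pos: "0 < Im (\<gamma> s)" if "s \<in> {0..1}" for s
    using subsetD[OF im, of "\<gamma> s"] that by (simp add: path_image_def upper_half_plane_def)
  have b: "0 < b" using a ab by auto
  \<comment> \<open>The speed is continuous only off \<open>S\<close>; setting it to zero on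
    \<open>S\<close> makes it Borel measurable, as the splitting of the integral requires.\<close>
  define G where "G s = ennreal (Psi a b (Im (\<gamma> s)) * cmod (d s)) * indicator ({0..1} - S) s" for s
  have "continuous_on ({0..1} - S) (\<lambda>s. Psi a b (Im (\<gamma> s)) * cmod (d s))"
    using cont' pos
    by (intro continuous_intros continuous_on_compose2[OF continuous_on_Psi] continuous_on_subset[OF cont])
      (auto simp: d_def)
  then have "(\<lambda>s. ennreal (Psi a b (Im (\<gamma> s)) * cmod (d s))) \<in> borel_measurable (restrict_space borel ({0..1} - S))"
    by (intro measurable_compose[OF _ measurable_ennreal] borel_measurable_continuous_on_restrict)
  moreover have "({0..1} - S) \<inter> space borel \<in> sets borel"
    using finite_imp_closed[OF S] by (intro sets.Int sets.Diff borel_closed) auto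
  ultimately have [measurable]: "G \<in> borel_measurable borel"
    unfolding G_def[abs_def] by (subst (asm) borel_measurable_restrict_space_iff_ennreal)
  have le: "(\<integral>\<^sup>+s\<in>{0..1}. G s \<partial>lborel) \<le> riem_length (g_metric a b) \<gamma>"
    unfolding riem_length_def
    by (intro nn_integral_mono) (auto simp: G_def d_def indicator_def sqrt_g_metric pos)
  have v: "ennreal \<bar>lam a b (Im (\<gamma> v)) - lam a b (Im (\<gamma> u))\<bar> \<le> (\<integral>\<^sup>+s\<in>{u..v}. G s \<partial>lborel)"
    if uv: "0 \<le> u" "u \<le> v" "v \<le> 1" for u v
  proof (rule FTC_le_nn_integral[OF S uv(2)])
    have "continuous_on {0<..} (lam a b)"
      by (rule DERIV_continuous_on) (auto intro: has_real_derivative_lam)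
    then show "continuous_on {u..v} (\<lambda>s. lam a b (Im (\<gamma> s)))"
      by (rule continuous_on_compose2)
        (use pos uv in \<open>auto intro!: continuous_on_Im continuous_on_subset[OF cont]\<close>)
    fix s assume "s \<in> {u<..<v} - S"
    then have s: "s \<in> {0..1} - S" and p: "0 < Im (\<gamma> s)" using uv pos by auto
    have "((\<lambda>s. Im (\<gamma> s)) has_real_derivative Im (d s)) (at s)"
      using der[OF s] by (simp add: has_vector_derivative_complex_iff)
    then show "((\<lambda>s. lam a b (Im (\<gamma> s))) has_real_derivative lam' a b (Im (\<gamma> s)) * Im (d s)) (at s)"
      by (rule DERIV_chain2[where f = "lam a b" and x = s and g = "\<lambda>s. Im (\<gamma> s)", OF has_real_derivative_lam[OF p]])
    have "\<bar>lam' a b (Im (\<gamma> s))\<bar> \<le> Psi a b (Im (\<gamma> s))"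
      using lam'_pos[OF p] lam'_le_Psi[OF p] by simp
    then have "\<bar>lam' a b (Im (\<gamma> s)) * Im (d s)\<bar> \<le> Psi a b (Im (\<gamma> s)) * cmod (d s)"
      unfolding abs_mult by (intro mult_mono abs_Im_le_cmod) auto
    then show "ennreal \<bar>lam' a b (Im (\<gamma> s)) * Im (d s)\<bar> \<le> G s"
      using s by (simp add: G_def ennreal_leI)
  qed
  have "ennreal (2 * h - lam a b (Im (\<gamma> 0)) - lam a b (Im (\<gamma> 1)))
      = ennreal \<bar>h - lam a b (Im (\<gamma> 0))\<bar> + ennreal \<bar>lam a b (Im (\<gamma> 1)) - h\<bar>"
    using lam_mono[OF pos max, of 0] lam_mono[OF pos max, of 1]
    by (subst ennreal_plus[symmetric]) (auto simp: h_def)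
  also have "\<dots> \<le> (\<integral>\<^sup>+s\<in>{0..t}. G s \<partial>lborel) + (\<integral>\<^sup>+s\<in>{t..1}. G s \<partial>lborel)"
    unfolding h_def using t by (intro add_mono v) auto
  also have "\<dots> = (\<integral>\<^sup>+s\<in>{0..1}. G s \<partial>lborel)"
    using t by (intro nn_integral_split_Icc) auto
  finally show ?A using le by (simp add: pathstart_def pathfinish_def)
  have bt: "0 < b * Im (\<gamma> t)" using b pos[OF t] by simp
  have "ennreal \<bar>Re (\<gamma> 1) / (b * Im (\<gamma> t)) - Re (\<gamma> 0) / (b * Im (\<gamma> t))\<bar>
      \<le> (\<integral>\<^sup>+s\<in>{0..1}. G s \<partial>lborel)"
  proof (rule FTC_le_nn_integral[OF S])
    show "continuous_on {0..1} (\<lambda>s. Re (\<gamma> s) / (b * Im (\<gamma> t)))"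
      using bt by (intro continuous_intros cont) auto
    fix s assume "s \<in> {0<..<1} - S"
    then have s: "s \<in> {0..1} - S" and p: "0 < Im (\<gamma> s)" using pos by auto
    have "((\<lambda>s. Re (\<gamma> s)) has_real_derivative Re (d s)) (at s)"
      using der[OF s] by (simp add: has_vector_derivative_complex_iff)
    then show "((\<lambda>s. Re (\<gamma> s) / (b * Im (\<gamma> t))) has_real_derivative Re (d s) / (b * Im (\<gamma> t))) (at s)"
      by (rule DERIV_cdivide)
    have "\<bar>Re (d s) / (b * Im (\<gamma> t))\<bar> = 1 / (b * Im (\<gamma> t)) * \<bar>Re (d s)\<bar>"
      using bt by simp
    also have "\<dots> \<le> 1 / (b * Im (\<gamma> s)) * cmod (d s)"
      using b p max[of s] s bt abs_Re_le_cmod by (intro mult_mono divide_left_mono) auto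
    also have "\<dots> \<le> Psi a b (Im (\<gamma> s)) * cmod (d s)"
      by (intro mult_right_mono Psi_ge[OF p]) auto
    finally show "ennreal \<bar>Re (d s) / (b * Im (\<gamma> t))\<bar> \<le> G s"
      using s by (simp add: G_def ennreal_leI)
  qed simp
  then show ?B using le bt by (simp add: pathstart_def pathfinish_def diff_divide_distrib[symmetric])
qed

text \<open>The infimum over paths is below \<open>r\<close>, so some path is shorter than
  \<open>r\<close>; \<open>H\<close> is its peak height.\<close>

lemma riem_ball_bounds:
  assumes w: "w \<in> riem_ball upper_half_plane (g_metric a b) z r"
  obtains H where "Im z \<le> H" "Im w \<le> H" "\<bar>Re w - Re z\<bar> \<le> r * b * H"
    "2 * lam a b H \<le> r + lam a b (Im z) + lam a b (Im w)" "0 < Im w"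
proof -
  obtain \<gamma> where \<gamma>: "valid_path \<gamma>" "path_image \<gamma> \<subseteq> upper_half_plane"
    "pathstart \<gamma> = z" "pathfinish \<gamma> = w" and len: "riem_length (g_metric a b) \<gamma> < ennreal r"
    using w unfolding riem_ball_def riem_dist_def by (auto simp: INF_less_iff)
  have "continuous_on {0..1} (\<lambda>t. Im (\<gamma> t))"
    using valid_path_imp_path[OF \<gamma>(1)] by (auto simp: path_def intro: continuous_intros)
  then obtain t where t: "t \<in> {0..1}" "\<And>s. s \<in> {0..1} \<Longrightarrow> Im (\<gamma> s) \<le> Im (\<gamma> t)"
    using continuous_attains_sup[of "{0..1::real}"] by force
  have r: "0 < r" using le_less_trans[OF zero_le len] by simp
  have ends: "z = \<gamma> 0" "w = \<gamma> 1" using \<gamma> by (auto simp: pathstart_def pathfinish_def)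
  have pos: "0 < Im w" "0 < Im (\<gamma> t)"
    using subsetD[OF \<gamma>(2)] ends t by (auto simp: path_image_def upper_half_plane_def)
  note bounds = riem_length_bounds[OF \<gamma>(1,2) t, THEN order.strict_trans1, OF _ len]
  show thesis
  proof (rule that)
    show "Im z \<le> Im (\<gamma> t)" "Im w \<le> Im (\<gamma> t)" "0 < Im w" using t(2) ends pos by auto
    have "\<not> r \<le> 2 * lam a b (Im (\<gamma> t)) - lam a b (Im z) - lam a b (Im w)"
      using leD[OF ennreal_leI] bounds(1) unfolding \<gamma>(3,4) by blast
    then show "2 * lam a b (Im (\<gamma> t)) \<le> r + lam a b (Im z) + lam a b (Im w)" by linarith
    have "\<bar>Re w - Re z\<bar> / (b * Im (\<gamma> t)) < r"
      using bounds(2) r \<gamma> a ab pos by (simp add: ennreal_less_iff)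
    then show "\<bar>Re w - Re z\<bar> \<le> r * b * Im (\<gamma> t)"
      using a ab pos by (simp add: divide_less_eq mult.assoc)
  qed
qed

text \<open>The path rises to height about \<open>K\<close>, with its horizontal speed concentrated at the top, where
  horizontal steps are cheap.\<close>

lemma riem_dist_le:
  assumes z: "0 < Im z" and w: "0 < Im w" and K: "0 < K"
    and Kx: "\<bar>Re w - Re z\<bar> \<le> K" and Ky: "\<bar>Im w - Im z\<bar> \<le> K"
  shows "riem_dist upper_half_plane (g_metric a b) z w
    \<le> ennreal (2 * lam a b (Im z + Im w + K) - lam a b (Im z) - lam a b (Im w)
        + 2 * b * (1 / a - 1 / b)\<^sup>2 + 6 / a)"
proof -
  \<comment> \<open>\<open>e\<close> bounds the total excess of \<open>Psi\<close> over
    \<open>lam'\<close> on any interval of heights.\<close>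
  define e where "e = b * (1 / a - 1 / b)\<^sup>2"
  have e: "0 \<le> e" using a ab by (simp add: e_def)
  \<comment> \<open>The derivative of \<open>3 * t\<^sup>2 - 2 * t ^ 3\<close> is
    \<open>6 * t * (1 - t)\<close>, proportional to the parabola added to the height below. So the
    horizontal speed is at most six times the height, and costs at most
    \<open>6 / a\<close>.\<close>
  define x where "x t = Re z + (Re w - Re z) * (3 * t\<^sup>2 - 2 * t ^ 3)" for t
  define x' where "x' t = (Re w - Re z) * (6 * t * (1 - t))" for t
  define y where "y t = Im z + (Im w - Im z) * t + K * t * (1 - t)" for t
  define y' where "y' t = (Im w - Im z) + K * (1 - 2 * t)" for t
  \<comment> \<open>\<open>U\<close> is a primitive of the majorant \<open>u\<close> of
    \<open>Psi\<close>, and lies within \<open>e\<close> below \<open>lam\<close>.\<close>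
  define U where "U s = lam a b s - e / (1 + s)" for s
  define u where "u s = lam' a b s + e / (1 + s)\<^sup>2" for s
  \<comment> \<open>The time at which the quadratic \<open>y\<close> peaks; it lies in the unit
    interval because \<open>\<bar>Im w - Im z\<bar> \<le> K\<close>.\<close>
  define c where "c = (1 + (Im w - Im z) / K) / 2"
  have c: "0 \<le> c" "c \<le> 1" using K Ky by (auto simp: c_def field_simps abs_le_iff)
  have [derivative_intros]: "(x has_real_derivative x' t) (at t)"
      "(y has_real_derivative y' t) (at t)" for t
    unfolding x_def[abs_def] x'_def y_def[abs_def] y'_def
    by (auto intro!: derivative_eq_intros simp: power2_eq_square algebra_simps)
  define \<gamma> where "\<gamma> t = Complex (x t) (y t)" for t
  have der: "(\<gamma> has_vector_derivative Complex (x' t) (y' t)) (at t)" for t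
    unfolding \<gamma>_def[abs_def] has_vector_derivative_complex_iff
    by (auto simp flip: has_real_derivative_iff_has_vector_derivative intro!: derivative_intros)
  then have vd: "vector_derivative \<gamma> (at t) = Complex (x' t) (y' t)" for t
    by (rule vector_derivative_at)
  have "continuous_on {0..1} (\<lambda>t. vector_derivative \<gamma> (at t))"
    unfolding vd Complex_eq x'_def y'_def by (intro continuous_intros)
  then have valid: "valid_path \<gamma>"
    using der unfolding valid_path_def
    by (intro C1_differentiable_imp_piecewise)
      (auto simp: C1_differentiable_on_eq intro: differentiableI_vector)
  have ylow: "K * (t * (1 - t)) \<le> y t" and ypos: "0 < y t" if "t \<in> {0..1}" for t
  proof -
    have "0 < (1 - t) * Im z + t * Im w"
      using that z w by (cases "t = 1") (auto intro!: add_pos_nonneg)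
    then have "0 < Im z + (Im w - Im z) * t" by (simp add: algebra_simps)
    moreover have "0 \<le> K * (t * (1 - t))" using that K by simp
    ultimately show "K * (t * (1 - t)) \<le> y t" "0 < y t" by (auto simp: y_def)
  qed
  have [derivative_intros]: "(U has_real_derivative u s) (at s)" if "0 < s" for s
    unfolding U_def[abs_def] u_def using that
    by (auto intro!: derivative_eq_intros has_real_derivative_lam simp: power2_eq_square)
  have horiz: "Psi a b (y t) * \<bar>x' t\<bar> \<le> 6 / a" if t: "t \<in> {0..1}" for t
  proof -
    have "Psi a b (y t) * \<bar>x' t\<bar> \<le> 1 / (a * y t) * (6 * y t)"
    proof (intro mult_mono Psi_le[OF ypos[OF t]])
      have "\<bar>x' t\<bar> = \<bar>Re w - Re z\<bar> * (6 * (t * (1 - t)))"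
        using t by (simp add: x'_def abs_mult)
      also have "\<dots> \<le> K * (6 * (t * (1 - t)))"
        using t Kx by (intro mult_right_mono) auto
      also have "\<dots> \<le> 6 * y t" using ylow[OF t] by simp
      finally show "\<bar>x' t\<bar> \<le> 6 * y t" .
    qed (use a ypos[OF t] in auto)
    then show ?thesis using ypos[OF t] a by simp
  qed
  have vert: "Psi a b (y t) * \<bar>y' t\<bar> \<le> u (y t) * \<bar>y' t\<bar>" if t: "t \<in> {0..1}" for t
    using Psi_le_lam'[OF ypos[OF t]] by (intro mult_right_mono) (auto simp: u_def e_def)
  define G where "G t = Psi a b (y t) * cmod (Complex (x' t) (y' t))" for t
  have G0: "0 \<le> G t" if "t \<in> {0..1}" for t
    using Psi_nonneg[OF ypos[OF that]] by (simp add: G_def)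
  have G: "G t \<le> u (y t) * \<bar>y' t\<bar> + 6 / a" if t: "t \<in> {0..1}" for t
  proof -
    have "G t \<le> Psi a b (y t) * (\<bar>x' t\<bar> + \<bar>y' t\<bar>)"
      unfolding G_def using Psi_nonneg[OF ypos[OF t]] cmod_le[of "Complex (x' t) (y' t)"]
      by (intro mult_left_mono) auto
    then show ?thesis using horiz[OF t] vert[OF t] by (simp add: distrib_left)
  qed
  have [measurable]: "y \<in> borel_measurable borel" "y' \<in> borel_measurable borel"
    unfolding y_def[abs_def] y'_def[abs_def] by measurable
  have [measurable]: "(\<lambda>t. u (y t)) \<in> borel_measurable borel"
    unfolding u_def lam'_def by measurable
  have y'_eq: "y' t = 2 * K * (c - t)" for t
    using K by (simp add: y'_def c_def field_simps)
  have up: "(\<integral>\<^sup>+t\<in>{0..c}. ennreal (G t) \<partial>lborel) \<le> ennreal ((U (y c) + 6 / a * c) - (U (y 0) + 6 / a * 0))"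
  proof (rule nn_integral_le_FTC[where h = "\<lambda>t. u (y t) * y' t + 6 / a"])
    fix t assume t: "t \<in> {0..c}"
    then have t1: "t \<in> {0..1}" using c by auto
    show "((\<lambda>t. U (y t) + 6 / a * t) has_real_derivative u (y t) * y' t + 6 / a) (at t)"
      by (rule derivative_eq_intros DERIV_chain2[of U] ypos t1 refl | simp)+
    show "G t \<le> u (y t) * y' t + 6 / a"
      using G[OF t1] t K by (simp add: y'_eq abs_mult)
  qed (use c G0 in auto)
  have down: "(\<integral>\<^sup>+t\<in>{c..1}. ennreal (G t) \<partial>lborel) \<le> ennreal ((6 / a * 1 - U (y 1)) - (6 / a * c - U (y c)))"
  proof (rule nn_integral_le_FTC[where h = "\<lambda>t. 6 / a - u (y t) * y' t"])
    fix t assume t: "t \<in> {c..1}"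
    then have t1: "t \<in> {0..1}" using c by auto
    show "((\<lambda>t. 6 / a * t - U (y t)) has_real_derivative 6 / a - u (y t) * y' t) (at t)"
      by (rule derivative_eq_intros DERIV_chain2[of U] ypos t1 refl | simp)+
    have "u (y t) * \<bar>y' t\<bar> = - (u (y t) * y' t)"
      using t K by (simp add: y'_eq abs_mult algebra_simps)
    then show "G t \<le> 6 / a - u (y t) * y' t" using G[OF t1] by simp
  qed (use c G0 in auto)
  have Umono: "U s \<le> U s'" if "0 < s" "s \<le> s'" for s s'
    using lam_mono[OF that] e that
    by (auto simp: U_def intro!: diff_mono divide_left_mono mult_pos_pos)
  have yc: "y 0 \<le> y c" "y 1 \<le> y c"
  proof -
    have "y c - y t = K * (c - t)\<^sup>2" for t
      using K by (simp add: y_def c_def power2_eq_square field_simps)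
    then show "y 0 \<le> y c" "y 1 \<le> y c" 
      using K by (metis diff_ge_0_iff_ge mult_nonneg_nonneg less_imp_le zero_le_power2)+
  qed
  have y01: "y 0 = Im z" "y 1 = Im w" by (auto simp: y_def)
  have "riem_length (g_metric a b) \<gamma> = (\<integral>\<^sup>+t\<in>{0..1}. ennreal (G t) \<partial>lborel)"
    unfolding riem_length_def vd
    by (intro nn_integral_cong)
      (auto simp: indicator_def G_def \<gamma>_def sqrt_g_metric ypos)
  also have "\<dots> = (\<integral>\<^sup>+t\<in>{0..c}. ennreal (G t) \<partial>lborel) + (\<integral>\<^sup>+t\<in>{c..1}. ennreal (G t) \<partial>lborel)"
    using c by (intro nn_integral_split_Icc[symmetric])
      (auto simp: G_def[abs_def] Psi_def x'_def y_def y'_def cmod_def)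
  also have "\<dots> \<le> ennreal ((U (y c) + 6 / a * c) - (U (y 0) + 6 / a * 0))
      + ennreal ((6 / a * 1 - U (y 1)) - (6 / a * c - U (y c)))"
    by (intro add_mono up down)
  \<comment> \<open>Each of the two summands is nonnegative, so \<open>ennreal\<close> may be taken
    after adding them.\<close>
  also have "\<dots> = ennreal (2 * U (y c) - U (y 0) - U (y 1) + 6 / a)"
  proof -
    have "0 \<le> 6 / a * c" "6 / a * c \<le> 6 / a * 1"
      using a c by (intro mult_nonneg_nonneg mult_left_mono; simp)+
    moreover have "U (y 0) \<le> U (y c)" "U (y 1) \<le> U (y c)"
      using Umono yc z w y01 by auto
    ultimately show ?thesis
      by (subst ennreal_plus[symmetric]) (auto simp del: times_divide_eq_left intro!: arg_cong[of _ _ ennreal])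
  qed
  also have "\<dots> \<le> ennreal (2 * lam a b (Im z + Im w + K) - lam a b (Im z) - lam a b (Im w) + 2 * e + 6 / a)"
  proof (rule ennreal_leI)
    have "y c \<le> Im z + Im w + K"
    proof -
      have "K * c * (1 - c) \<le> K * 1 * 1" using c K by (intro mult_mono) auto
      moreover have "(1 - c) * Im z + c * Im w \<le> 1 * Im z + 1 * Im w"
        using c z w by (intro add_mono mult_right_mono) auto
      ultimately show ?thesis by (simp add: y_def algebra_simps)
    qed
    then have "U (y c) \<le> U (Im z + Im w + K)"
      using ypos[of c] c by (intro Umono) auto
    also have "\<dots> \<le> lam a b (Im z + Im w + K)" using e z w K by (simp add: U_def)
    finally have "U (y c) \<le> lam a b (Im z + Im w + K)" .
    \<comment> \<open>Going back from \<open>U\<close> to \<open>lam\<close> costs \<open>e\<close>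
      at each endpoint, hence the \<open>2 * e\<close>.\<close>
    moreover have "lam a b s - e \<le> U s" if "0 < s" for s
      using that e by (simp add: U_def field_simps)
    ultimately show "2 * U (y c) - U (y 0) - U (y 1) + 6 / a
        \<le> 2 * lam a b (Im z + Im w + K) - lam a b (Im z) - lam a b (Im w) + 2 * e + 6 / a"
      using z w y01 by (smt (verit))
  qed
  finally have "riem_length (g_metric a b) \<gamma>
    \<le> ennreal (2 * lam a b (Im z + Im w + K) - lam a b (Im z) - lam a b (Im w) + 2 * e + 6 / a)" .
  moreover have "path_image \<gamma> \<subseteq> upper_half_plane"
    using ypos by (auto simp: path_image_def upper_half_plane_def \<gamma>_def)
  moreover have "pathstart \<gamma> = z" "pathfinish \<gamma> = w"
    by (auto simp: pathstart_def pathfinish_def \<gamma>_def x_def y_def complex_eq_iff)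
  ultimately show ?thesis
    using valid unfolding riem_dist_def e_def by (intro INF_lower2[of \<gamma>]) (auto simp: mult.assoc)
qed

subsection \<open>Volumes\<close>

abbreviation (input) "\<mu> \<equiv> riem_measure upper_half_plane (g_metric a b)"

lemma sets_riem_measure: "A \<in> sets \<mu> \<longleftrightarrow> A \<in> sets borel \<and> A \<subseteq> upper_half_plane"
  by (auto simp: riem_measure_def sets_restrict_space_iff)

text \<open>The metric is conformal, so its Gram determinant is the fourth power of
  \<open>Psi\<close> and the area density is the square.\<close>

lemma emeasure_riem_measure:
  assumes "A \<in> sets borel" "A \<subseteq> upper_half_plane"
  shows "emeasure \<mu> A = (\<integral>\<^sup>+z\<in>A. ennreal ((Psi a b (Im z))\<^sup>2) \<partial>lborel)"
proof -
  have "sqrt (u ^ 2 * u ^ 2) = u ^ 2" for u :: real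
    by (simp only: real_sqrt_mult real_sqrt_abs) (simp flip: power2_eq_square)
  then have "\<mu> = density (restrict_space lborel upper_half_plane) (\<lambda>z. ennreal ((Psi a b (Im z))\<^sup>2))"
    by (simp add: riem_measure_def g_metric_def)
  moreover have "(\<lambda>z. ennreal ((Psi a b (Im z))\<^sup>2)) \<in> borel_measurable (restrict_space lborel upper_half_plane)"
    unfolding Psi_def by (intro measurable_restrict_space1) measurable
  ultimately have "emeasure \<mu> A
      = (\<integral>\<^sup>+z\<in>A. ennreal ((Psi a b (Im z))\<^sup>2) \<partial>restrict_space lborel upper_half_plane)"
    by (simp add: emeasure_density assms sets_restrict_space_iff)
  also have "\<dots> = (\<integral>\<^sup>+z\<in>A. ennreal ((Psi a b (Im z))\<^sup>2) \<partial>lborel)"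
    using assms(2) by (subst nn_integral_restrict_space)
     (auto intro!: nn_integral_cong simp: indicator_def)
  finally show ?thesis .
qed

text \<open>On the strip \<open>Psi\<close> is comparable to \<open>1 / s\<close>, and the Lebesgue
  area is comparable to \<open>X * s\<close>. The numerical constants come from
  \<open>2 \<le> exp 1 \<le> 3\<close>.\<close>

lemma emeasure_strip:
  assumes X: "0 \<le> X" and s: "0 < s"
  shows emeasure_strip_le: "emeasure \<mu> (strip x X s) \<le> ennreal (4 * X / (a\<^sup>2 * s))" (is ?le)
    and emeasure_strip_ge: "ennreal (2 * X / (9 * b\<^sup>2 * s)) \<le> emeasure \<mu> (strip x X s)" (is ?ge)
proof -
  have [measurable]: "strip x X s \<in> sets borel" by (simp add: strip_def)
  note eq = emeasure_riem_measure[OF this strip_subset_upper_half_plane[OF s]]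
  have b: "0 < b" using a ab by simp
  have e: "exp 1 \<le> (3::real)" "2 \<le> exp (1::real)" using exp_le exp_ge_add_one_self[of 1] by auto
  have const: "(\<integral>\<^sup>+z\<in>strip x X s. ennreal k \<partial>lborel) = ennreal (k * (2 * X * ((exp 1 - 1) * s)))"
    if "0 \<le> k" for k
    using that X s by (simp add: nn_integral_cmult_indicator emeasure_lborel_strip ennreal_mult)
  have "emeasure \<mu> (strip x X s) \<le> (\<integral>\<^sup>+z\<in>strip x X s. ennreal ((1 / (a * s))\<^sup>2) \<partial>lborel)"
    unfolding eq
  proof (intro set_nn_integral_mono ennreal_leI power_mono)
    fix z assume "z \<in> strip x X s"
    then have z: "s \<le> Im z" by (simp add: in_strip_iff)
    then have "Psi a b (Im z) \<le> 1 / (a * Im z)" using s by (intro Psi_le) auto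
    also have "\<dots> \<le> 1 / (a * s)" using z s a by (intro divide_left_mono mult_left_mono) auto
    finally show "Psi a b (Im z) \<le> 1 / (a * s)" .
    show "0 \<le> Psi a b (Im z)" using z s by (intro Psi_nonneg) auto
  qed
  also have "\<dots> = ennreal ((1 / (a * s))\<^sup>2 * (2 * X * ((exp 1 - 1) * s)))" by (rule const) simp
  also have "\<dots> \<le> ennreal ((1 / (a * s))\<^sup>2 * (2 * X * (2 * s)))"
    using e X s by (intro ennreal_leI mult_left_mono mult_right_mono) auto
  also have "(1 / (a * s))\<^sup>2 * (2 * X * (2 * s)) = 4 * X / (a\<^sup>2 * s)"
    using a s by (simp add: power2_eq_square field_simps)
  finally show ?le .
  have "2 * X / (9 * b\<^sup>2 * s) = (1 / (b * (3 * s)))\<^sup>2 * (2 * X * (1 * s))"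
    using b s by (simp add: power2_eq_square field_simps)
  also have "ennreal \<dots> \<le> ennreal ((1 / (b * (3 * s)))\<^sup>2 * (2 * X * ((exp 1 - 1) * s)))"
    using e X s by (intro ennreal_leI mult_left_mono mult_right_mono) auto
  also have "\<dots> = (\<integral>\<^sup>+z\<in>strip x X s. ennreal ((1 / (b * (3 * s)))\<^sup>2) \<partial>lborel)"
    by (rule const[symmetric]) simp
  also have "\<dots> \<le> emeasure \<mu> (strip x X s)"
    unfolding eq
  proof (intro set_nn_integral_mono ennreal_leI power_mono)
    fix z assume "z \<in> strip x X s"
    then have z: "s \<le> Im z" "Im z \<le> exp 1 * s" by (auto simp: in_strip_iff)
    then have "Im z \<le> 3 * s" using mult_right_mono[OF e(1), of s] s by linarith
    then have "1 / (b * (3 * s)) \<le> 1 / (b * Im z)"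
      using z s b by (intro divide_left_mono mult_left_mono) auto
    also have "\<dots> \<le> Psi a b (Im z)" using z s by (intro Psi_ge) auto
    finally show "1 / (b * (3 * s)) \<le> Psi a b (Im z)" .
    show "0 \<le> 1 / (b * (3 * s))" using b s by simp
  qed
  finally show ?ge .
qed

text \<open>The ball is covered by \<open>O(r)\<close> strips of equal measure.\<close>

lemma emeasure_riem_ball_le:
  assumes z: "0 < Im z" and r: "0 \<le> r" and Q: "0 \<le> Q"
    and H: "\<And>w H. 0 < Im w \<Longrightarrow> Im z \<le> H \<Longrightarrow> Im w \<le> H \<Longrightarrow>
      lam a b (Im z) \<le> r + lam a b (Im w) \<Longrightarrow>
      2 * lam a b H \<le> r + lam a b (Im z) + lam a b (Im w) \<Longrightarrow> H \<le> Q * Im w"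
  shows "emeasure \<mu> (riem_ball upper_half_plane (g_metric a b) z r)
    \<le> ennreal ((2 * b * r + 1) * (12 * r * b * Q / a\<^sup>2))"
proof -
  \<comment> \<open>By \<open>ln_diff_le_lam\<close> heights in the ball differ from
    \<open>Im z\<close> by a factor of at most \<open>exp (b * r)\<close>, so the bottoms start at
    the lowest such height and climb in unit logarithmic steps.\<close>
  define s where "s k = Im z * exp (real k - b * r)" for k
  \<comment> \<open>The horizontal displacement is at most \<open>r * b * H\<close>, with
    \<open>H \<le> Q * Im w\<close> and \<open>Im w\<close> at most the top
    \<open>exp 1 * s k\<close> of the strip.\<close>
  define X where "X k = r * b * Q * (exp 1 * s k)" for k
  define N where "N = nat \<lfloor>2 * b * r\<rfloor>"
  have b: "0 < b" using a ab by simp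
  have s: "0 < s k" for k using z by (simp add: s_def)
  have X: "0 \<le> X k" for k using r b Q s[of k] by (simp add: X_def)
  have strip: "strip (Re z) (X k) (s k) \<in> sets \<mu>" for k
    using strip_subset_upper_half_plane[OF s] unfolding sets_riem_measure by (simp add: strip_def)
  have "riem_ball upper_half_plane (g_metric a b) z r \<subseteq> (\<Union>k\<le>N. strip (Re z) (X k) (s k))"
  proof
    fix w assume "w \<in> riem_ball upper_half_plane (g_metric a b) z r"
    then obtain h where h: "Im z \<le> h" "Im w \<le> h" "\<bar>Re w - Re z\<bar> \<le> r * b * h"
      "2 * lam a b h \<le> r + lam a b (Im z) + lam a b (Im w)" and w: "0 < Im w"
      by (rule riem_ball_bounds)
    have lo: "lam a b (Im z) \<le> r + lam a b (Im w)"
      using h(4) lam_mono[OF z h(1)] lam_mono[OF w h(2)] by linarith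
    have hi: "lam a b (Im w) \<le> r + lam a b (Im z)"
      using h(4) lam_mono[OF w h(2)] lam_mono[OF z h(1)] by linarith
    have hQ: "h \<le> Q * Im w" by (rule H[OF w h(1,2) lo h(4)])
    \<comment> \<open>The logarithmic height of \<open>w\<close> above the lowest bottom; its
      integer part selects the strip.\<close>
    define u where "u = ln (Im w) - ln (Im z) + b * r"
    have "\<bar>ln (Im w) - ln (Im z)\<bar> \<le> b * r"
    proof (cases "Im z \<le> Im w")
      case True
      then have "0 \<le> ln (Im w) - ln (Im z)" using z by simp
      moreover have "b * (lam a b (Im w) - lam a b (Im z)) \<le> b * r"
        using hi b by (intro mult_left_mono) auto
      ultimately show ?thesis using ln_diff_le_lam[OF z True] by simp
    next
      case False
      then have "0 \<le> ln (Im z) - ln (Im w)" using w by simp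
      moreover have "b * (lam a b (Im z) - lam a b (Im w)) \<le> b * r"
        using lo b by (intro mult_left_mono) auto
      ultimately show ?thesis using ln_diff_le_lam[OF w, of "Im z"] False by simp
    qed
    then have u: "0 \<le> u" "u \<le> 2 * b * r" by (auto simp: u_def abs_le_iff)
    define k where "k = nat \<lfloor>u\<rfloor>"
    have k: "real k \<le> u" "u \<le> real k + 1" "k \<le> N"
      using u by (auto simp: k_def N_def nat_mono floor_mono)
    have Imw: "Im w = Im z * exp (u - b * r)"
      using z w by (simp add: u_def exp_diff)
    have "s k \<le> Im w" "Im w \<le> exp 1 * s k"
      using k z by (auto simp: Imw s_def mult_exp_exp simp flip: exp_add)
    moreover have "\<bar>Re w - Re z\<bar> \<le> X k"
    proof -
      have "r * b * h \<le> r * b * (Q * (exp 1 * s k))"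
        using hQ mult_left_mono[OF calculation(2) Q] r b by (intro mult_left_mono) auto
      then show ?thesis using h(3) by (simp add: X_def mult.assoc)
    qed
    ultimately show "w \<in> (\<Union>k\<le>N. strip (Re z) (X k) (s k))"
      using k(3) by (auto simp: in_strip_iff)
  qed
  \<comment> \<open>Monotonicity asks for measurability of the cover only: \<open>emeasure\<close>
    is zero on non-measurable sets, so the upper bound holds for the ball in any case.\<close>
  then have "emeasure \<mu> (riem_ball upper_half_plane (g_metric a b) z r)
      \<le> emeasure \<mu> (\<Union>k\<le>N. strip (Re z) (X k) (s k))"
    using strip by (intro emeasure_mono sets.finite_UN) auto
  also have "\<dots> \<le> (\<Sum>k\<le>N. emeasure \<mu> (strip (Re z) (X k) (s k)))"
    using strip by (intro emeasure_subadditive_finite) auto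
  also have "\<dots> \<le> (\<Sum>k\<le>N. ennreal (12 * r * b * Q / a\<^sup>2))"
  proof (intro sum_mono order_trans[OF emeasure_strip_le[OF X s]] ennreal_leI)
    fix k
    have "4 * X k / (a\<^sup>2 * s k) = exp 1 * (4 * r * b * Q / a\<^sup>2)"
      using s[of k] by (simp add: X_def)
    also have "\<dots> \<le> 3 * (4 * r * b * Q / a\<^sup>2)"
      using r b Q by (intro mult_right_mono exp_le) auto
    finally show "4 * X k / (a\<^sup>2 * s k) \<le> 12 * r * b * Q / a\<^sup>2" by simp
  qed
  also have "\<dots> = ennreal ((real N + 1) * (12 * r * b * Q / a\<^sup>2))"
    using r b Q by (subst sum_ennreal) (auto simp: add.commute)
  also have "\<dots> \<le> ennreal ((2 * b * r + 1) * (12 * r * b * Q / a\<^sup>2))"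
    using r b Q by (intro ennreal_leI mult_right_mono add_right_mono) (auto simp: N_def)
  finally show ?thesis .
qed

subsection \<open>Unboundedness\<close>

abbreviation (input) "hball \<equiv> riem_ball upper_half_plane (g_metric a b)"

text \<open>\<open>riem_dist_le\<close> with \<open>K = 3 * exp L\<close>: both points have height
  at most \<open>3 * exp L\<close>, so the peak is at most \<open>9 * exp L\<close>, where
  \<open>lam_le_b\<close> applies. The heights of the points are bounded below by the bottoms of
  their strips.\<close>

lemma riem_dist_strips:
  assumes L: "1 \<le> L" and s: "0 < s" "s \<le> exp L" and s': "0 < s'" "s' \<le> exp L"
    and z: "z \<in> strip 0 (exp L) s" and w: "w \<in> strip 0 (exp L) s'"
  shows "riem_dist upper_half_plane (g_metric a b) z w
    \<le> ennreal (2 / b * L - lam a b s - lam a b s'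
        + (2 / b * ln 9 + 2 * b * (1 / a - 1 / b)\<^sup>2 + 6 / a))"
proof -
  have e: "exp 1 * s \<le> 3 * exp L" "exp 1 * s' \<le> 3 * exp L"
    using s s' exp_le by (auto intro!: mult_mono)
  have z': "\<bar>Re z\<bar> \<le> exp L" "s \<le> Im z" "Im z \<le> 3 * exp L"
    and w': "\<bar>Re w\<bar> \<le> exp L" "s' \<le> Im w" "Im w \<le> 3 * exp L"
    using z w e by (auto simp: in_strip_iff)
  have pos: "0 < Im z" "0 < Im w" using z' w' s s' by auto
  have "lam a b (Im z + Im w + 3 * exp L) \<le> lam a b (9 * exp L)"
    using pos z' w' by (intro lam_mono) auto
  also have "\<dots> \<le> ln (9 * exp L) / b" by (intro lam_le_b) auto
  also have "\<dots> = (ln 9 + L) / b" by (simp add: ln_mult)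
  finally have "2 * lam a b (Im z + Im w + 3 * exp L) \<le> 2 / b * L + 2 / b * ln 9"
    by (simp add: add_divide_distrib)
  moreover have "lam a b s \<le> lam a b (Im z)" "lam a b s' \<le> lam a b (Im w)"
    using s s' z' w' by (auto intro!: lam_mono)
  ultimately have "2 * lam a b (Im z + Im w + 3 * exp L) - lam a b (Im z) - lam a b (Im w)
        + 2 * b * (1 / a - 1 / b)\<^sup>2 + 6 / a
      \<le> 2 / b * L - lam a b s - lam a b s' + (2 / b * ln 9 + 2 * b * (1 / a - 1 / b)\<^sup>2 + 6 / a)"
    by linarith
  moreover have "\<bar>Re w - Re z\<bar> \<le> 3 * exp L" "\<bar>Im w - Im z\<bar> \<le> 3 * exp L"
    using z' w' pos exp_gt_zero[of L] by (auto simp: abs_le_iff)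
  ultimately show ?thesis
    using order_trans[OF riem_dist_le[OF pos, of "3 * exp L"] ennreal_leI] by simp
qed

text \<open>With \<open>X = exp L\<close>, the test function is the indicator of the strip at height \<open>exp (\<sigma> * L)\<close>, the
  maximal function is estimated on the strip at height \<open>exp (\<tau> * L)\<close>, and \<open>exp (\<kappa> * L)\<close> is, up to
  powers of \<open>L\<close>, the measure of the balls.\<close>

lemma not_bounded_on_Lp:
  fixes p \<sigma> \<tau> \<alpha> \<beta> \<kappa> D :: real
  assumes p: "1 \<le> p" and \<sigma>: "\<sigma> \<le> 1" and \<tau>: "\<tau> \<le> 1" and \<alpha>: "0 \<le> \<alpha>" and \<beta>: "1 < \<beta>"
    and dist: "\<And>L z w. 1 \<le> L \<Longrightarrow> z \<in> strip 0 (exp L) (exp (\<tau> * L)) \<Longrightarrow>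
      w \<in> strip 0 (exp L) (exp (\<sigma> * L)) \<Longrightarrow>
      riem_dist upper_half_plane (g_metric a b) z w < ennreal (\<alpha> * L + \<beta>)"
    and Q: "\<And>L y y' H. 1 \<le> L \<Longrightarrow> exp (\<tau> * L) \<le> y \<Longrightarrow> y \<le> exp 1 * exp (\<tau> * L) \<Longrightarrow> 0 < y' \<Longrightarrow>
      y \<le> H \<Longrightarrow> y' \<le> H \<Longrightarrow> lam a b y \<le> \<alpha> * L + \<beta> + lam a b y' \<Longrightarrow>
      2 * lam a b H \<le> \<alpha> * L + \<beta> + lam a b y + lam a b y' \<Longrightarrow> ln H \<le> \<kappa> * L + D + ln y'"
    and \<delta>: "0 < p * (1 - \<sigma> - \<kappa>) - \<tau> + \<sigma>"
  shows "\<not> bounded_on_Lp \<mu> p (maximal_infty upper_half_plane (g_metric a b))"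
proof
  assume bd: "bounded_on_Lp \<mu> p (maximal_infty upper_half_plane (g_metric a b))"
  have b: "0 < b" using a ab by simp
  have p0: "0 < p" using p by simp
  obtain C where C: "0 \<le> C" "\<And>E Z m. E \<in> fmeasurable \<mu> \<Longrightarrow> Z \<in> fmeasurable \<mu> \<Longrightarrow> 0 \<le> m \<Longrightarrow>
      (\<And>z. z \<in> Z \<Longrightarrow> ennreal m \<le> maximal_infty upper_half_plane (g_metric a b) (indicator E) z) \<Longrightarrow>
      m powr p * measure \<mu> Z \<le> C * measure \<mu> E"
    by (rule bounded_on_Lp_weak_type[OF bd p0]) blast
  \<comment> \<open>The radius \<open>\<alpha> * L + \<beta>\<close> is at most
    \<open>\<rho> * (L + 1)\<close>, which turns the volume bound into
    \<open>K * (L + 1)\<^sup>2 * exp (\<kappa> * L)\<close>.\<close>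
  define \<rho> where "\<rho> = \<alpha> + \<beta>"
  have \<rho>: "1 < \<rho>" using \<alpha> \<beta> by (simp add: \<rho>_def)
  define K where "K = (2 * b * \<rho> + 1) * (12 * \<rho> * b / a\<^sup>2) * exp D"
  define c where "c = 2 / (9 * b\<^sup>2)"
  have c: "0 < c" using b by (simp add: c_def)
  have K: "0 < K"
    unfolding K_def using a b \<rho>
    by (intro mult_pos_pos divide_pos_pos add_pos_pos exp_gt_zero zero_less_power) auto
  show False
  proof (rule exp_growth_contradiction[OF p0 c c K])
    show "0 < p * ((1 - \<sigma>) - \<kappa>) + (1 - \<tau>) - (1 - \<sigma>)" using \<delta> by simp
    fix L :: real assume L: "1 \<le> L"
    define E where "E = strip 0 (exp L) (exp (\<sigma> * L))"
    define Z where "Z = strip 0 (exp L) (exp (\<tau> * L))"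
    define r where "r = \<alpha> * L + \<beta>"
    define V where "V = K * (L + 1)\<^sup>2 * exp (\<kappa> * L)"
    \<comment> \<open>\<open>1 < \<beta>\<close> makes the radius admissible in the supremum over
      \<open>r > 1\<close>.\<close>
    have r: "1 < r" "r \<le> \<rho> * (L + 1)"
      using mult_nonneg_nonneg[of \<alpha> L] mult_nonneg_nonneg[of \<beta> L] \<alpha> \<beta> L
      unfolding r_def \<rho>_def distrib_left distrib_right by linarith+
    have V: "0 < V" using K L by (simp add: V_def)
    have up: "emeasure \<mu> (strip 0 (exp L) (exp (t * L))) \<le> ennreal (4 / a\<^sup>2 * exp ((1 - t) * L))"
      and lo: "ennreal (c * exp ((1 - t) * L)) \<le> emeasure \<mu> (strip 0 (exp L) (exp (t * L)))" 
      and sets: "strip 0 (exp L) (exp (t * L)) \<in> sets \<mu>" for t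
      using emeasure_strip[of "exp L" "exp (t * L)" 0] strip_subset_upper_half_plane[of "exp (t * L)" 0 "exp L"]
      by (simp_all add: c_def exp_diff left_diff_distrib sets_riem_measure strip_def)
    have fm: "strip 0 (exp L) (exp (t * L)) \<in> fmeasurable \<mu>" for t
      using sets up[of t] by (intro fmeasurableI) (auto intro: le_less_trans)
    have up': "measure \<mu> (strip 0 (exp L) (exp (t * L))) \<le> 4 / a\<^sup>2 * exp ((1 - t) * L)"
      and lo': "c * exp ((1 - t) * L) \<le> measure \<mu> (strip 0 (exp L) (exp (t * L)))" for t
      using up[of t] lo[of t] fm[of t] c a by (auto simp: emeasure_eq_measure2)
    have "ennreal (c * exp ((1 - \<sigma>) * L) / V) \<le> maximal_infty upper_half_plane (g_metric a b) (indicator E) z"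
      if z: "z \<in> Z" for z
    proof -
      have zp: "0 < Im z" and z1: "exp (\<tau> * L) \<le> Im z" "Im z \<le> exp 1 * exp (\<tau> * L)"
        using z by (auto simp: Z_def in_strip_iff intro: less_le_trans[OF exp_gt_zero])
      \<comment> \<open>The peak-to-height ratio is bounded by exponentiating the logarithmic
        hypothesis on \<open>H\<close>.\<close>
      have "emeasure \<mu> (hball z r) \<le> ennreal ((2 * b * r + 1) * (12 * r * b * exp (\<kappa> * L + D) / a\<^sup>2))"
      proof (rule emeasure_riem_ball_le[OF zp])
        fix w H assume w: "0 < Im w" "Im z \<le> H" "Im w \<le> H" "lam a b (Im z) \<le> r + lam a b (Im w)"
          "2 * lam a b H \<le> r + lam a b (Im z) + lam a b (Im w)"
        have "ln H \<le> \<kappa> * L + D + ln (Im w)"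
          using Q[OF L z1 w(1-3)] w(4,5) by (simp add: r_def)
        then have "exp (ln H) \<le> exp (\<kappa> * L + D + ln (Im w))" by simp
        then show "H \<le> exp (\<kappa> * L + D) * Im w" using w zp by (simp add: exp_add)
      qed (use r in auto)
      also have "\<dots> \<le> ennreal V"
      proof (rule ennreal_leI)
        have "(2 * b * r + 1) * (12 * r * b * exp (\<kappa> * L + D) / a\<^sup>2)
            = (2 * b * r + 1) * r * (12 * b * exp (\<kappa> * L + D) / a\<^sup>2)" by simp
        also have "\<dots> \<le> ((2 * b * \<rho> + 1) * (L + 1)) * (\<rho> * (L + 1)) * (12 * b * exp (\<kappa> * L + D) / a\<^sup>2)"
        proof (intro mult_right_mono mult_mono r(2))
          have "2 * b * r + 1 \<le> 2 * b * (\<rho> * (L + 1)) + 1 * (L + 1)"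
            using r(2) b L by (intro add_mono mult_left_mono) auto
          then show "2 * b * r + 1 \<le> (2 * b * \<rho> + 1) * (L + 1)" by (simp add: algebra_simps)
        qed (use b r L \<rho> in auto)
        also have "\<dots> = V" by (simp add: V_def K_def exp_add power2_eq_square)
        finally show "(2 * b * r + 1) * (12 * r * b * exp (\<kappa> * L + D) / a\<^sup>2) \<le> V" .
      qed
      finally have vol: "emeasure \<mu> (hball z r) \<le> ennreal V" .
      have "E \<subseteq> hball z r"
        using dist[OF L, of z] z strip_subset_upper_half_plane[of "exp (\<sigma> * L)"]
        by (auto simp: riem_ball_def E_def Z_def r_def)
      then have "emeasure \<mu> E / ennreal V \<le> maximal_infty upper_half_plane (g_metric a b) (indicator E) z"
        using vol sets r(1) by (intro maximal_infty_indicator_ge[of r]) (auto simp: E_def)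
      moreover have "ennreal (c * exp ((1 - \<sigma>) * L) / V) \<le> emeasure \<mu> E / ennreal V"
        using lo[of \<sigma>] V c by (subst divide_ennreal[symmetric]) (auto simp: E_def intro!: divide_right_mono_ennreal)
      ultimately show ?thesis by (rule order_trans[rotated])
    qed
    then have "(c * exp ((1 - \<sigma>) * L) / V) powr p * measure \<mu> Z \<le> C * measure \<mu> E"
      using fm V c by (intro C(2)) (auto simp: E_def Z_def)
    moreover have "(c * exp ((1 - \<sigma>) * L) / V) powr p * (c * exp ((1 - \<tau>) * L))
        \<le> (c * exp ((1 - \<sigma>) * L) / V) powr p * measure \<mu> Z"
      unfolding Z_def by (intro mult_left_mono lo') auto
    moreover have "C * measure \<mu> E \<le> C * (4 / a\<^sup>2 * exp ((1 - \<sigma>) * L))"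
      unfolding E_def by (intro mult_left_mono up' C(1))
    ultimately show "(c * exp ((1 - \<sigma>) * L) / (K * (L + 1)\<^sup>2 * exp (\<kappa> * L))) powr p * (c * exp ((1 - \<tau>) * L))
        \<le> (C * (4 / a\<^sup>2)) * exp ((1 - \<sigma>) * L)"
      by (simp add: V_def mult.assoc)
  qed
qed

text \<open>From height one to height \<open>exp L\<close>, the distance \<open>2 * L / b\<close> is
  reduced by \<open>lam\<close> of the target, leaving \<open>L / b\<close>. The exponent condition
  becomes \<open>p * a / b < 1\<close>. \<open>b < 2 * a\<close> makes the lowest points of the ball
  the worst for the peak-to-height ratio.\<close>

lemma not_bounded_on_Lp_small_ratio:
  assumes b2a: "b < 2 * a" and p: "1 \<le> p" "p < b / a"
  shows "\<not> bounded_on_Lp \<mu> p (maximal_infty upper_half_plane (g_metric a b))"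
proof -
  have b: "0 < b" using a ab by simp
  define e where "e = (1 / a - 1 / b) * ln 2"
  define k where "k = 2 / b * ln 9 + 2 * b * (1 / a - 1 / b)\<^sup>2 + 6 / a"
  \<comment> \<open>\<open>k\<close> is the distance error and each \<open>e\<close> the error of
    \<open>lam\<close> on one strip; the final \<open>2\<close> gives strictness and
    \<open>1 < \<beta>\<close>.\<close>
  define \<beta> where "\<beta> = k + 2 * e + 2"
  have e: "0 \<le> e" using inverse_diff_pos by (simp add: e_def)
  have k: "0 \<le> k" using a b by (simp add: k_def)
  have lam1: "- e \<le> lam a b 1" using lam_ge_a[of 1] by (simp add: e_def)
  show ?thesis
  proof (rule not_bounded_on_Lp[where \<sigma> = 1 and \<tau> = 0 and \<alpha> = "1 / b" and \<beta> = \<beta>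
        and \<kappa> = "a / b" and D = "a * \<beta> + 1 / 2 + (a + b / 2) * e"])
    show "0 < p * (1 - 1 - a / b) - 0 + 1" using p a b by (simp add: field_simps)
    show "1 < \<beta>" using k e by (simp add: \<beta>_def)
  next
    fix L :: real and z w
    assume L: "1 \<le> L" and z: "z \<in> strip 0 (exp L) (exp (0 * L))" and w: "w \<in> strip 0 (exp L) (exp (1 * L))"
    have "riem_dist upper_half_plane (g_metric a b) z w
        \<le> ennreal (2 / b * L - lam a b (exp (0 * L)) - lam a b (exp (1 * L)) + k)"
      unfolding k_def using L by (intro riem_dist_strips z w) auto
    also have "\<dots> < ennreal (1 / b * L + \<beta>)"
    proof (rule ennreal_lessI)
      have "L / b - e \<le> lam a b (exp L)" using lam_ge_b[of "exp L"] L by (simp add: e_def)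
      then show "2 / b * L - lam a b (exp (0 * L)) - lam a b (exp (1 * L)) + k < 1 / b * L + \<beta>"
        using lam1 by (simp add: \<beta>_def)
      show "0 < 1 / b * L + \<beta>" using k e L b by (simp add: \<beta>_def add_nonneg_pos)
    qed
    finally show "riem_dist upper_half_plane (g_metric a b) z w < ennreal (1 / b * L + \<beta>)" .
  next
    fix L y y' H :: real
    assume L: "1 \<le> L" and y: "exp (0 * L) \<le> y" "y \<le> exp 1 * exp (0 * L)" and y': "0 < y'"
      and H: "y \<le> H" "y' \<le> H" and 1: "lam a b y \<le> 1 / b * L + \<beta> + lam a b y'"
      and 2: "2 * lam a b H \<le> 1 / b * L + \<beta> + lam a b y + lam a b y'"
    define r where "r = 1 / b * L + \<beta>"
    define t where "t = ln y' / a"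
    have y1: "1 \<le> y" "ln y \<le> 1" using y ln_le_cancel_iff[of y "exp 1"] by (auto simp del: ln_le_cancel_iff)
    have t: "lam a b y' \<le> t" using lam_le_a[OF y'] by (simp add: t_def)
    have "- e \<le> lam a b y" using lam1 lam_mono[of 1 y] y1 by simp
    then have t_ge: "- (e + r) \<le> t" using 1 t by (simp add: r_def)
    have "lam a b y \<le> ln y / b" using y1 by (intro lam_le_b) auto
    also have "\<dots> \<le> 1 / b" using y1 b by (intro divide_right_mono) auto
    finally have "2 * lam a b H \<le> r + 1 / b + t" using 2 t by (simp add: r_def)
    then have "lam a b H + e \<le> (r + 1 / b + t) / 2 + e" by simp
    moreover have "ln H / b \<le> lam a b H + e" using lam_ge_b[of H] H y1 by (simp add: e_def)
    ultimately have "ln H / b \<le> (r + 1 / b + t) / 2 + e" by (rule order_trans[rotated])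
    then have "ln H \<le> b * ((r + 1 / b + t) / 2 + e)" using b by (simp add: divide_le_eq mult.commute)
    \<comment> \<open>Splitting off \<open>a * t = ln y'\<close> leaves \<open>- t\<close> with the
      coefficient \<open>a - b / 2\<close>, positive here, so the lower bound on \<open>t\<close>
      can be inserted.\<close>
    also have "\<dots> = b / 2 * r + 1 / 2 + b * e + a * t + (a - b / 2) * (- t)"
      using b by (simp add: field_simps)
    also have "\<dots> \<le> b / 2 * r + 1 / 2 + b * e + a * t + (a - b / 2) * (e + r)"
      using t_ge b2a by (intro add_left_mono mult_left_mono) auto
    also have "\<dots> = a / b * L + (a * \<beta> + 1 / 2 + (a + b / 2) * e) + ln y'"
      using a b by (simp add: r_def t_def field_simps)
    finally show "ln H \<le> a / b * L + (a * \<beta> + 1 / 2 + (a + b / 2) * e) + ln y'" .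
  qed (use p b in auto)
qed

text \<open>The measures of the balls and of the test set grow at the same rate, so \<open>p\<close>
  drops out of the exponent condition, which becomes \<open>0 < \<theta>\<close>.\<close>

lemma not_bounded_on_Lp_large_ratio:
  assumes b2a: "2 * a < b" and p: "1 \<le> p"
  shows "\<not> bounded_on_Lp \<mu> p (maximal_infty upper_half_plane (g_metric a b))"
proof -
  have b: "0 < b" using a ab by simp
  \<comment> \<open>Starting at height \<open>exp (- \<theta> * L)\<close> adds about
    \<open>\<theta> * L / a\<close> to the distance \<open>2 * L / b\<close>, for a total of
    \<open>L / a\<close>.\<close>
  define \<theta> where "\<theta> = 1 - 2 * a / b"
  define e where "e = (1 / a - 1 / b) * ln 2"
  define k where "k = 2 / b * ln 9 + 2 * b * (1 / a - 1 / b)\<^sup>2 + 6 / a"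
  define \<beta> where "\<beta> = k + 2 * e + 2"
  define D1 where "D1 = b / 2 * (\<beta> + 1 / a + 2 * e)"
  define D2 where "D2 = a * \<beta> + 3 / 2 * a * e + 1 / 2"
  have \<theta>: "0 < \<theta>" using b2a b by (simp add: \<theta>_def field_simps)
  have \<theta>_eq: "\<theta> / a = 1 / a - 2 / b" using a by (simp add: \<theta>_def field_simps)
  have e: "0 \<le> e" using inverse_diff_pos by (simp add: e_def)
  have k: "0 \<le> k" using a b by (simp add: k_def)
  have \<beta>: "1 < \<beta>" using k e by (simp add: \<beta>_def)
  have D: "0 \<le> D1" "0 \<le> D2" using a b e \<beta> by (auto simp: D1_def D2_def)
  have lam1: "- e \<le> lam a b 1" using lam_ge_a[of 1] by (simp add: e_def)
  show ?thesis
  proof (rule not_bounded_on_Lp[where \<sigma> = 0 and \<tau> = "- \<theta>" and \<alpha> = "1 / a" and \<beta> = \<beta>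
        and \<kappa> = 1 and D = "D1 + D2"])
    fix L :: real and z w
    assume L: "1 \<le> L" and z: "z \<in> strip 0 (exp L) (exp (- \<theta> * L))" and w: "w \<in> strip 0 (exp L) (exp (0 * L))"
    have \<theta>L: "0 \<le> \<theta> * L" using \<theta> L by simp
    have "riem_dist upper_half_plane (g_metric a b) z w
        \<le> ennreal (2 / b * L - lam a b (exp (- \<theta> * L)) - lam a b (exp (0 * L)) + k)"
      unfolding k_def
      by (intro riem_dist_strips z w) (use L \<theta>L in auto)
    also have "\<dots> < ennreal (1 / a * L + \<beta>)"
    proof (rule ennreal_lessI)
      have "- (\<theta> * L) / a - e \<le> lam a b (exp (- \<theta> * L))"
        using lam_ge_a[of "exp (- \<theta> * L)"] \<theta>L by (simp add: e_def)
      moreover have "\<theta> * L / a = 1 / a * L - 2 / b * L"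
        using arg_cong[OF \<theta>_eq, of "\<lambda>u. u * L"] by (simp add: left_diff_distrib)
      ultimately show "2 / b * L - lam a b (exp (- \<theta> * L)) - lam a b (exp (0 * L)) + k < 1 / a * L + \<beta>"
        using lam1 by (simp add: \<beta>_def)
      show "0 < 1 / a * L + \<beta>" using \<beta> L a by (simp add: add_nonneg_pos)
    qed
    finally show "riem_dist upper_half_plane (g_metric a b) z w < ennreal (1 / a * L + \<beta>)" .
  next
    fix L y y' H :: real
    assume L: "1 \<le> L" and y: "exp (- \<theta> * L) \<le> y" "y \<le> exp 1 * exp (- \<theta> * L)" and y': "0 < y'"
      and H: "y \<le> H" "y' \<le> H" and 1: "lam a b y \<le> 1 / a * L + \<beta> + lam a b y'"
      and 2: "2 * lam a b H \<le> 1 / a * L + \<beta> + lam a b y + lam a b y'"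
    have y0: "0 < y" by (rule less_le_trans[OF exp_gt_zero y(1)])
    have lny: "- (\<theta> * L) \<le> ln y" "ln y \<le> 1 - \<theta> * L"
      using y y0 ln_le_cancel_iff[of y "exp (1 - \<theta> * L)"]
      by (auto simp: ln_ge_iff mult_exp_exp simp del: ln_le_cancel_iff)
    have "lam a b y \<le> ln y / a" by (rule lam_le_a[OF y0])
    also have "\<dots> \<le> (1 - \<theta> * L) / a" using lny a by (intro divide_right_mono) auto
    also have "\<dots> = 1 / a - 1 / a * L + 2 / b * L"
      using arg_cong[OF \<theta>_eq, of "\<lambda>u. u * L"] by (simp add: diff_divide_distrib left_diff_distrib)
    finally have 3: "2 * lam a b H \<le> 2 / b * L + \<beta> + 1 / a + lam a b y'" using 2 by simp
    show "ln H \<le> 1 * L + (D1 + D2) + ln y'"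
    proof (cases "1 \<le> H")
      case True
      then have "ln H / b \<le> lam a b H + e" using lam_ge_b[of H] by (simp add: e_def)
      also have "\<dots> \<le> (2 / b * L + \<beta> + 1 / a + lam a b y') / 2 + e" using 3 by simp
      finally have "ln H / b \<le> (2 / b * L + \<beta> + 1 / a + lam a b y') / 2 + e" .
      then have "ln H \<le> b * ((2 / b * L + \<beta> + 1 / a + lam a b y') / 2 + e)"
        using b by (simp add: divide_le_eq mult.commute)
      also have "\<dots> = L + D1 + b / 2 * lam a b y'"
        using a b by (simp add: D1_def field_simps)
      \<comment> \<open>Above height one the slope of \<open>lam_le_b\<close> gives half the
        logarithm. Below it the logarithm is negative, and \<open>b / (2 * a) > 1\<close> from
        \<open>2 * a < b\<close> gives the bound.\<close>
      also have "b / 2 * lam a b y' \<le> ln y'"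
      proof (cases "1 \<le> y'")
        case True
        have "b / 2 * lam a b y' \<le> b / 2 * (ln y' / b)" using b by (intro mult_left_mono lam_le_b y') auto
        also have "\<dots> \<le> ln y'" using True b by simp
        finally show ?thesis .
      next
        case False
        have "b / 2 * lam a b y' \<le> b / 2 * (ln y' / a)" using b by (intro mult_left_mono lam_le_a y') auto
        also have "\<dots> = b / (2 * a) * ln y'" by simp
        also have "\<dots> \<le> 1 * ln y'"
          using False y' b2a a by (intro mult_right_mono_neg) auto
        finally show ?thesis by simp
      qed
      finally show ?thesis using D by simp
    next
      case False
      define t where "t = ln y' / a"
      have t: "lam a b y' \<le> t" using lam_le_a[OF y'] by (simp add: t_def)
      \<comment> \<open>A path staying below height one sees only the slope \<open>1 / a\<close>;
        the radius then limits how low \<open>y'\<close> can be.\<close>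
      have "- (1 / a * L - 2 / b * L) = - (\<theta> * L) / a"
        using arg_cong[OF \<theta>_eq, of "\<lambda>u. u * L"] by (simp add: left_diff_distrib)
      also have "\<dots> \<le> ln y / a" using lny a by (intro divide_right_mono) auto
      also have "\<dots> \<le> lam a b y + e" using lam_ge_a[OF y0] H False by (simp add: e_def)
      also have "\<dots> \<le> (1 / a * L + \<beta> + t) + e" using 1 t by simp
      finally have t_ge: "- t \<le> 2 / a * L - 2 / b * L + e + \<beta>" by simp
      have "ln H / a \<le> lam a b H + e" using lam_ge_a[of H] H y0 False by (simp add: e_def)
      also have "\<dots> \<le> (2 / b * L + \<beta> + 1 / a + t) / 2 + e" using 3 t by simp
      finally have "ln H / a \<le> (2 / b * L + \<beta> + 1 / a + t) / 2 + e" .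
      then have "ln H \<le> a * ((2 / b * L + \<beta> + 1 / a + t) / 2 + e)"
        using a by (simp add: divide_le_eq mult.commute)
      \<comment> \<open>Splitting off \<open>a * t = ln y'\<close> leaves
        \<open>a / 2 * (- t)\<close>; inserting the bound on \<open>- t\<close> cancels the
        \<open>L / b\<close> terms and leaves exactly \<open>L\<close>.\<close>
      also have "\<dots> = a / 2 * (2 / b * L + \<beta> + 1 / a + 2 * e) + a / 2 * (- t) + a * t"
        by (simp add: algebra_simps)
      also have "\<dots> \<le> a / 2 * (2 / b * L + \<beta> + 1 / a + 2 * e) + a / 2 * (2 / a * L - 2 / b * L + e + \<beta>) + a * t"
        using t_ge a by (intro add_right_mono add_left_mono mult_left_mono) auto
      also have "\<dots> = L + D2 + ln y'"
        using a by (simp add: D2_def t_def field_simps)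
      finally show ?thesis using D by simp
    qed
  qed (use p a \<theta> \<beta> in auto)
qed

end

theorem theorem7p1:
  fixes a b :: real
  assumes "0 < a" and "a < b"
  shows "(b < 2 * a \<longrightarrow>
      (\<forall>p::real. 1 \<le> p \<and> p < b / a \<longrightarrow>
        \<not> bounded_on_Lp (riem_measure upper_half_plane (g_metric a b)) p
            (maximal_infty upper_half_plane (g_metric a b))))
    \<and> (b > 2 * a \<longrightarrow>
      (\<forall>p::real. 1 \<le> p \<longrightarrow>
        \<not> bounded_on_Lp (riem_measure upper_half_plane (g_metric a b)) p
            (maximal_infty upper_half_plane (g_metric a b))))"
  using not_bounded_on_Lp_small_ratio[OF assms] not_bounded_on_Lp_large_ratio[OF assms] by simp

end
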